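(* Let $(\mathcal{Z},d_{\mathcal{Z}})$ be a Polish space which is a totally bounded metric space, and let $H$ be a Polish space with metric $d_H$. Let $(S_n)_{n\in\mathbb{N}}$, $S_n:\mathcal{Z}^n\to H$, be a sequence of estimators represented by a statistical operator $S:\mathcal{M}(\mathcal{Z})\to H$, i.e. $S_n(z_1,\dots,z_n)=S\big(\frac1n\sum_{i=1}^n\delta_{z_i}\big)$ for all $n\in\mathbb{N}$ and $(z_1,\dots,z_n)\in\mathcal{Z}^n$. Let $P_{\mathbb{N}}=\bigotimes_{i\in\mathbb{N}}P^i$, $P^i\in\mathcal{M}(\mathcal{Z})$, be an infinite product measure such that the coordinate process $(Z_i)_{i\in\mathbb{N}}$ on $\mathcal{Z}^{\mathbb{N}}$ is, under $P_{\mathbb{N}}$, a strong Varadarajan process with limiting distribution $P\in\mathcal{M}(\mathcal{Z})$. Let $\mathcal{P}:=\{Q_{\mathbb{N}}\in\mathcal{M}(\mathcal{Z}^{\mathbb{N}}):\ Q_{\mathbb{N}}=\bigotimes_{i\in\mathbb{N}}Q^i,\ Q^i\in\mathcal{M}(\mathcal{Z})\}$. Assume that $S$ is continuous at $P$ with respect to $d_{\mathrm{BL}}$ and that $S_n:\mathcal{Z}^n\to H$ is continuous for every $n\in\mathbb{N}$. Then the sequence of bootstrap approximations $(\mathcal{L}_{P_n^*}(S_n))_{n\in\mathbb{N}}$ (with Efron's empirical bootstrap) is qualitatively robust at $P_{\mathbb{N}}$ with respect to $\mathcal{P}$; that is, for every $\varepsilon>0$ there are $\delta>0$ and $n_0\in\mathbb{N}$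 such that for every $n\ge n_0$ and every $Q_{\mathbb{N}}\in\mathcal{P}$, $$d_{\mathrm{BL}}(P_n,Q_n)<\delta\ \Rightarrow\ d_{\mathrm{BL}}\big(\mathcal{L}(\mathcal{L}_{P_n^*}(S_n)),\mathcal{L}(\mathcal{L}_{Q_n^*}(S_n))\big)<\varepsilon .$$
   Context: All topological spaces carry their Borel $\sigma$-algebras. $\mathcal{M}(\mathcal{X})$ denotes the set of Borel probability measures on $\mathcal{X}$; for a Polish space $\mathcal{X}$, $\mathcal{M}(\mathcal{X})$ with the weak topology is Polish. $\mathcal{M}(\mathcal{Z}^{\mathbb{N}})$ is the set of probability measures on $\mathcal{Z}^{\mathbb{N}}$ with the product $\sigma$-algebra. The coordinate process is $Z_i:\mathcal{Z}^{\mathbb{N}}\to\mathcal{Z}$, $(z_j)_{j\in\mathbb{N}}\mapsto z_i$. For $P_{\mathbb{N}}\in\mathcal{M}(\mathcal{Z}^{\mathbb{N}})$, $P_n$ denotes the law of $(Z_1,\dots,Z_n)$ under $P_{\mathbb{N}}$ (similarly $Q_n$ for $Q_{\mathbb{N}}$). Bounded Lipschitz metric: for a separable metric space $(\mathcal{X},d)$ and $\mu,\nu\in\mathcal{M}(\mathcal{X})$, $d_{\mathrm{BL}}(\mu,\nu)=\sup\{|\int f\,d\mu-\int f\,d\nu| : f:\mathcal{X}\to\mathbb{R},\ \|f\|_{\mathrm{BL}}\le 1\}$, where $\|f\|_{\mathrm{BL}}=\sup_{x\ne y}\frac{|f(x)-f(y)|}{d(x,y)}+\sup_x|f(x)|$.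 On $\mathcal{M}(\mathcal{Z}^n)$ it is formed with respect to the metric $d_n\big((z_1,\dots,z_n),(z_1',\dots,z_n')\big)=\inf\{\varepsilon>0:\ \sharp\{i: d_{\mathcal{Z}}(z_i,z_i')\ge\varepsilon\}/n\le\varepsilon\}$ on $\mathcal{Z}^n$ (which induces the product topology). On $\mathcal{M}(\mathcal{M}(H))$ it is formed with respect to the metric $d_{\mathrm{BL}}$ on $\mathcal{M}(H)$. Continuity of $S_n$ is with respect to the product topology on $\mathcal{Z}^n$. Strong Varadarajan process: a process $(Z_i)_{i\in\mathbb{N}}$ with values in $\mathcal{Z}$ is a strong Varadarajan process with limiting distribution $P\in\mathcal{M}(\mathcal{Z})$ if $\pi\big(\frac1n\sum_{i=1}^n\delta_{Z_i},P\big)\to0$ almost surely as $n\to\infty$, where $\pi$ is the Prohorov metric. Efron's empirical bootstrap: let $(Z_1,\dots,Z_n)\sim P_n$. Conditionally on $(Z_1,\dots,Z_n)$, the bootstrap sample $Z_1^*,\dots,Z_n^*$ is drawn with replacement, i.e. it has law $\bigotimes_{i=1}^n\big(\frac1n\sum_{j=1}^n\delta_{Z_j}\big)$. The bootstrap approximation of $P_n$ is the random probability measure $P_n^*=\bigotimes_{i=1}^n\big(\frac1n\sum_{j=1}^n\delta_{Z_j^*}\big)$ on $\mathcal{Z}^n$. $\mathcal{L}_{P_n^*}(S_n)$ denotes the image measure of $P_n^*$ under $S_n$; it is a random element of $\mathcal{M}(H)$, and $\mathcal{L}(\mathcal{L}_{P_n^*}(S_n))\in\mathcal{M}(\mathcal{M}(H))$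 is its distribution. $Q_n^*$ and $\mathcal{L}(\mathcal{L}_{Q_n^*}(S_n))$ are defined in the same way starting from $Q_n$. *)

theory Defs
  imports "HOL-Probability.Probability"
begin

abbreviation prob_measures :: "'a measure \<Rightarrow> 'a measure set" where
  "prob_measures N \<equiv> space (prob_algebra N)"

abbreviation borel_prob_measures :: "'a::topological_space measure set" where
  "borel_prob_measures \<equiv> prob_measures borel"

text \<open>
  The bounded Lipschitz norm lives in \<^typ>\<open>ennreal\<close>, so that it is infinite for functions
  that are unbounded or not Lipschitz. The metric space is given by a carrier \<open>X\<close> and a
  distance \<open>d\<close>, because the norm is also needed on \<open>n\<close>-fold products and on spaces of measures.
\<close>

definition bl_norm :: "'a set \<Rightarrow> ('a \<Rightarrow> 'a \<Rightarrow> real) \<Rightarrow> ('a \<Rightarrow> real) \<Rightarrow> ennreal" where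
  "bl_norm X d f =
     (SUP (x, y) \<in> {(x, y). x \<in> X \<and> y \<in> X \<and> x \<noteq> y}. ennreal (\<bar>f x - f y\<bar> / d x y))
     + (SUP x \<in> X. ennreal \<bar>f x\<bar>)"

text \<open>
  For probability measures on \<open>X\<close> the supremum is over a nonempty set of reals bounded by 2.
\<close>

definition bl_dist ::
    "'a set \<Rightarrow> ('a \<Rightarrow> 'a \<Rightarrow> real) \<Rightarrow> 'a measure \<Rightarrow> 'a measure \<Rightarrow> real" where
  "bl_dist X d \<mu> \<nu> = (SUP f \<in> {f. bl_norm X d f \<le> 1}. \<bar>(\<integral>x. f x \<partial>\<mu>) - (\<integral>x. f x \<partial>\<nu>)\<bar>)"

definition prohorov_dist :: "'a::metric_space measure \<Rightarrow> 'a measure \<Rightarrow> real" where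
  "prohorov_dist \<mu> \<nu> =
     Inf {\<epsilon>. \<epsilon> > 0 \<and> (\<forall>A \<in> sets borel. measure \<mu> A \<le> measure \<nu> (\<Union>x\<in>A. ball x \<epsilon>) + \<epsilon>)}"

text \<open>
  Points of the \<open>n\<close>-fold product are extensional functions on \<open>{..<n}\<close>, that is, elements of
  \<open>{..<n} \<rightarrow>\<^sub>E UNIV\<close>; coordinates are numbered from 0. Only \<open>n \<ge> 1\<close> is meaningful below.
\<close>

definition sample_dist :: "nat \<Rightarrow> (nat \<Rightarrow> 'z::metric_space) \<Rightarrow> (nat \<Rightarrow> 'z) \<Rightarrow> real" where
  "sample_dist n z z' =
     Inf {\<epsilon>. \<epsilon> > 0 \<and> real (card {i \<in> {..<n}. dist (z i) (z' i) \<ge> \<epsilon>}) / real n \<le> \<epsilon>}"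

definition empirical :: "nat \<Rightarrow> (nat \<Rightarrow> 'z::topological_space) \<Rightarrow> 'z measure" where
  "empirical n z =
     measure_of UNIV (sets borel)
       (\<lambda>A. (1 / of_nat n) * (\<Sum>i<n. emeasure (return borel (z i)) A))"

definition strong_varadarajan ::
    "'w measure \<Rightarrow> (nat \<Rightarrow> 'w \<Rightarrow> 'z::metric_space) \<Rightarrow> 'z measure \<Rightarrow> bool" where
  "strong_varadarajan M Z P \<longleftrightarrow>
     prob_space M \<and> (\<forall>i. Z i \<in> borel_measurable M) \<and> P \<in> borel_prob_measures \<and>
     (AE \<omega> in M. (\<lambda>n. prohorov_dist (empirical n (\<lambda>i. Z i \<omega>)) P) \<longlonglongrightarrow> 0)"

definition product_laws :: "(nat \<Rightarrow> 'z::topological_space) measure set" where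
  "product_laws =
     {QN \<in> prob_measures (PiM UNIV (\<lambda>_. borel)).
        \<exists>Q. (\<forall>i. Q i \<in> borel_prob_measures) \<and> QN = PiM UNIV Q}"

definition marginal ::
    "nat \<Rightarrow> (nat \<Rightarrow> 'z::topological_space) measure \<Rightarrow> (nat \<Rightarrow> 'z) measure" where
  "marginal n PN = distr PN (PiM {..<n} (\<lambda>_. borel)) (\<lambda>\<omega>. restrict \<omega> {..<n})"

text \<open>
  The weak topology is the coarsest topology on the Borel probability measures for which
  \<open>\<mu> \<mapsto> \<integral>f d\<mu>\<close> is continuous for all bounded continuous \<open>f\<close>.
\<close>

definition weak_topology :: "'h::topological_space measure topology" where
  "weak_topology =
     topology_generated_by
       {{\<mu> \<in> borel_prob_measures. (\<integral>x. f x \<partial>\<mu>) \<in> U} | (f :: 'h \<Rightarrow> real) U.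
          continuous_on UNIV f \<and> bounded (range f) \<and> open U}"

definition weak_borel :: "'h::topological_space measure measure" where
  "weak_borel = sigma borel_prob_measures {U. openin weak_topology U}"

text \<open>
  \<open>resample n z\<close> is the \<open>n\<close>-fold product of the empirical measure of \<open>z\<close>. It is both the
  conditional law of the bootstrap sample given the data \<open>z\<close>, and, evaluated at the
  bootstrap sample, the bootstrap approximation of the law of the data.
\<close>

definition resample :: "nat \<Rightarrow> (nat \<Rightarrow> 'z::topological_space) \<Rightarrow> (nat \<Rightarrow> 'z) measure" where
  "resample n z = PiM {..<n} (\<lambda>_. empirical n z)"

definition bootstrap_sample_law ::
    "nat \<Rightarrow> (nat \<Rightarrow> 'z::topological_space) measure \<Rightarrow> (nat \<Rightarrow> 'z) measure" where
  "bootstrap_sample_law n Pn = Pn \<bind> resample n"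

definition bootstrap_law ::
    "nat \<Rightarrow> ((nat \<Rightarrow> 'z::topological_space) \<Rightarrow> 'h::topological_space) \<Rightarrow>
       (nat \<Rightarrow> 'z) measure \<Rightarrow> 'h measure measure" where
  "bootstrap_law n T Pn =
     distr (bootstrap_sample_law n Pn) weak_borel (\<lambda>z. distr (resample n z) borel T)"

end

theory Submission imports Defs begin

text \<open>
  Let \<open>P\<close> be the limiting distribution. For large \<open>n\<close> the bootstrap law is close to the Dirac
  measure at the Dirac measure at \<open>S P\<close>, both when the data come from \<open>PN\<close> and when they come from
  any \<open>QN\<close> with a nearby marginal. Robustness is then the triangle inequality through this
  common limit.

  Closeness is measured by one scalar statistic. On a totally bounded space there is, for each
  \<open>\<eta>\<close>, a finite Lipschitz partition of unity \<open>h 0, \<dots>, h (m - 1)\<close> subordinate to balls of radius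
  \<open>\<eta>\<close> (\<open>lipschitz_partition_exists\<close>). The discrepancy
  \<open>D z = (\<Sum>k<m. \<bar>mean of h k over z - \<integral>h k dP\<bar>)\<close> of a sample \<open>z\<close> has the following properties.

    \<^item> It bounds the bounded Lipschitz distance between the empirical measure of \<open>z\<close> and \<open>P\<close> up to
      \<open>2 * \<eta>\<close> (\<open>bl_dist_empirical_le\<close>). By continuity of \<open>S\<close> at \<open>P\<close> the truncated error
      \<open>min 2 (dist (S_n z) (S P))\<close> is therefore at most a small constant plus a multiple of \<open>D z\<close>.
    \<^item> Its mean tends to 0 under \<open>PN\<close>: Prohorov convergence of the empirical measures implies
      convergence of the integrals of each \<open>h k\<close>
      (\<open>integral_discrepancy_marginal_tendsto_0\<close>).
    \<^item> It is bounded, and Lipschitz for the metric on samples, with constants independent of \<open>n\<close>, so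
      its means under two laws of the data differ by at most a constant times their bounded
      Lipschitz distance (\<open>integral_discrepancy_le_bl_dist\<close>).
    \<^item> Resampling raises its conditional mean by at most \<open>m / sqrt n\<close>, whatever the sample, by a
      second moment estimate that is uniform in the law sampled from
      (\<open>integral_discrepancy_resample_le\<close>).

  The bootstrap resamples twice: once for the bootstrap sample and once for the
  bootstrap approximation. As all bounds are linear in the discrepancy, expectations can be chained
  through both rounds, which gives \<open>bootstrap_law_near_return\<close>.
\<close>

section \<open>The bounded Lipschitz distance\<close>

lemma bl_norm_le_1_D:
  assumes "bl_norm X d f \<le> 1" "x \<in> X"
  shows "\<bar>f x\<bar> \<le> 1"
    and "y \<in> X \<Longrightarrow> x \<noteq> y \<Longrightarrow> 0 < d x y \<Longrightarrow> \<bar>f x - f y\<bar> \<le> d x y"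
proof -
  let ?Lip = "SUP (x, y) \<in> {(x, y). x \<in> X \<and> y \<in> X \<and> x \<noteq> y}. ennreal (\<bar>f x - f y\<bar> / d x y)"
  let ?sup = "SUP x \<in> X. ennreal \<bar>f x\<bar>"
  have sum: "?Lip + ?sup \<le> 1"
    using assms(1) by (simp add: bl_norm_def)
  have "ennreal \<bar>f x\<bar> \<le> ?sup"
    using assms(2) by (rule SUP_upper)
  also have "\<dots> \<le> ?Lip + ?sup" by simp
  also note sum
  finally show "\<bar>f x\<bar> \<le> 1" by simp
  assume y: "y \<in> X" "x \<noteq> y" "0 < d x y"
  have "ennreal (\<bar>f x - f y\<bar> / d x y) \<le> ?Lip"
    using assms(2) y by (intro SUP_upper2[of "(x, y)"]) auto
  also have "\<dots> \<le> ?Lip + ?sup" by simp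
  also note sum
  finally show "\<bar>f x - f y\<bar> \<le> d x y"
    using y by (simp add: divide_le_eq)
qed

lemma bl_norm_le_1_I:
  assumes Lip: "\<And>x y. x \<in> X \<Longrightarrow> y \<in> X \<Longrightarrow> \<bar>f x - f y\<bar> \<le> L * d x y"
    and d: "\<And>x y. x \<in> X \<Longrightarrow> y \<in> X \<Longrightarrow> 0 \<le> d x y"
    and B: "\<And>x. x \<in> X \<Longrightarrow> \<bar>f x\<bar> \<le> B"
    and LB: "0 \<le> L" "0 \<le> B" "L + B \<le> 1"
  shows "bl_norm X d f \<le> 1"
proof -
  have quot: "\<bar>f x - f y\<bar> / d x y \<le> L" if "x \<in> X" "y \<in> X" for x y
  proof (cases "d x y = 0")
    case False
    with d[OF that] have "0 < d x y" by simp
    with Lip[OF that] show ?thesis by (simp add: divide_le_eq)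
  qed (simp add: LB)
  have "bl_norm X d f \<le> ennreal L + ennreal B"
    unfolding bl_norm_def
    by (intro add_mono SUP_least) (auto intro!: ennreal_leI quot B)
  also have "\<dots> = ennreal (L + B)" using LB by simp
  also have "\<dots> \<le> 1" using LB(3) by simp
  finally show ?thesis .
qed

lemma bl_dist_le:
  assumes "\<And>f. bl_norm X d f \<le> 1 \<Longrightarrow> \<bar>(\<integral>x. f x \<partial>\<mu>) - (\<integral>x. f x \<partial>\<nu>)\<bar> \<le> c"
  shows "bl_dist X d \<mu> \<nu> \<le> c"
proof -
  have "bl_norm X d (\<lambda>_. 0) \<le> 1"
    by (auto simp: bl_norm_def intro!: order_trans[OF add_mono[OF SUP_least SUP_least], of _ _ 0 _ _ 0])
  then have "{f. bl_norm X d f \<le> 1} \<noteq> {}" by blast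
  then show ?thesis
    unfolding bl_dist_def by (rule cSUP_least) (use assms in auto)
qed

text \<open>
  The defining supremum is bounded because a function of norm at most 1 has modulus at most 1
  on the carrier, so that its integral with respect to a probability measure is at most 1.
\<close>

lemma integral_diff_le_bl_dist:
  assumes "prob_space \<mu>" "prob_space \<nu>" "space \<mu> = X" "space \<nu> = X"
    and f: "bl_norm X d f \<le> 1"
  shows "\<bar>(\<integral>x. f x \<partial>\<mu>) - (\<integral>x. f x \<partial>\<nu>)\<bar> \<le> bl_dist X d \<mu> \<nu>"
  unfolding bl_dist_def
proof (rule cSUP_upper)
  have int: "\<bar>\<integral>x. g x \<partial>M\<bar> \<le> 1"
    if "prob_space M" "space M = X" "bl_norm X d g \<le> 1" for g M
  proof -
    interpret M: prob_space M by fact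
    have "\<bar>\<integral>x. g x \<partial>M\<bar> \<le> (\<integral>x. \<bar>g x\<bar> \<partial>M)" by simp
    also have "\<dots> \<le> (\<integral>x. 1 \<partial>M)"
      using bl_norm_le_1_D(1)[OF that(3)] that(2)
      by (intro integral_mono') auto
    finally show ?thesis by (simp add: M.prob_space)
  qed
  show "bdd_above ((\<lambda>f. \<bar>integral\<^sup>L \<mu> f - integral\<^sup>L \<nu> f\<bar>) ` {f. bl_norm X d f \<le> 1})"
  proof (intro bdd_aboveI2)
    fix g assume "g \<in> {f. bl_norm X d f \<le> 1}"
    with int[of \<mu> g] int[of \<nu> g] assms
    show "\<bar>integral\<^sup>L \<mu> g - integral\<^sup>L \<nu> g\<bar> \<le> 2" by auto
  qed
qed (use f in auto)

lemma bl_norm_dist_le_1_D: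
  fixes f :: "'a::metric_space \<Rightarrow> real"
  assumes "bl_norm UNIV dist f \<le> 1"
  shows "f \<in> borel_measurable borel"
    and "\<bar>f x - f y\<bar> \<le> dist x y"
    and "\<bar>f x\<bar> \<le> 1"
proof -
  have Lip: "\<bar>f x - f y\<bar> \<le> dist x y" for x y
    using bl_norm_le_1_D(2)[OF assms, of x y] by (cases "x = y") auto
  then show "\<bar>f x - f y\<bar> \<le> dist x y" .
  have "1-lipschitz_on UNIV f"
    by (intro lipschitz_onI) (auto simp: dist_real_def Lip)
  then show "f \<in> borel_measurable borel"
    by (intro borel_measurable_continuous_onI lipschitz_on_continuous_on)
  show "\<bar>f x\<bar> \<le> 1"
    by (rule bl_norm_le_1_D(1)[OF assms]) simp
qed

text \<open>
  Against a Dirac measure the distance needs no coupling: a test function varies by at most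
  \<open>min 2 (dist x s)\<close> between \<open>x\<close> and \<open>s\<close>.
\<close>

lemma bl_dist_return_le:
  fixes \<mu> :: "'a::metric_space measure"
  assumes "\<mu> \<in> borel_prob_measures"
  shows "bl_dist UNIV dist \<mu> (return borel s) \<le> (\<integral>x. min 2 (dist x s) \<partial>\<mu>)"
proof (rule bl_dist_le)
  from assms interpret prob_space \<mu> by (simp add: space_prob_algebra)
  have [measurable_cong, simp]: "sets \<mu> = sets borel"
    using assms by (simp add: space_prob_algebra)
  fix f :: "'a \<Rightarrow> real" assume "bl_norm UNIV dist f \<le> 1"
  note f = bl_norm_dist_le_1_D[OF this]
  note [measurable] = f(1)
  have [measurable]: "(\<lambda>x. dist x s) \<in> borel_measurable borel"
    by (intro borel_measurable_continuous_onI continuous_intros)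
  have int: "integrable \<mu> f"
    by (rule integrable_const_bound[of _ 1]) (auto simp: f(3))
  have "\<bar>(\<integral>x. f x \<partial>\<mu>) - (\<integral>x. f x \<partial>return borel s)\<bar> = \<bar>\<integral>x. f x - f s \<partial>\<mu>\<bar>"
    using int by (simp add: integral_return f(1) prob_space)
  also have "\<dots> \<le> (\<integral>x. \<bar>f x - f s\<bar> \<partial>\<mu>)" by simp
  also have "\<dots> \<le> (\<integral>x. min 2 (dist x s) \<partial>\<mu>)"
  proof (rule integral_mono')
    show "integrable \<mu> (\<lambda>x. min 2 (dist x s))"
      by (rule integrable_const_bound[of _ 2]) auto
    show "\<bar>f x - f s\<bar> \<le> min 2 (dist x s)" for x
      using f(2)[of x s] f(3)[of x] f(3)[of s] by auto
  qed auto
  finally show "\<bar>(\<integral>x. f x \<partial>\<mu>) - (\<integral>x. f x \<partial>return borel s)\<bar> \<le> (\<integral>x. min 2 (dist x s) \<partial>\<mu>)" .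
qed

text \<open>
  A Lipschitz quotient with vanishing denominator counts as 0, so a function of norm at most 1
  is controlled only where the distance is known to be positive. For a Dirac measure at \<open>s\<close>
  the test function \<open>min 1 (dist x s) / 2\<close> detects any mass away from \<open>s\<close>.
\<close>

lemma bl_dist_return_pos:
  fixes \<mu> :: "'a::metric_space measure"
  assumes "\<mu> \<in> borel_prob_measures" "\<mu> \<noteq> return borel s"
  shows "0 < bl_dist UNIV dist \<mu> (return borel s)"
proof -
  from assms(1) interpret prob_space \<mu> by (simp add: space_prob_algebra)
  have [measurable_cong, simp]: "sets \<mu> = sets borel"
    using assms by (simp add: space_prob_algebra)
  have [simp]: "space \<mu> = UNIV"
    using sets_eq_imp_space_eq[of \<mu> borel] by simp
  let ?g = "\<lambda>x. min 1 (dist x s) / 2"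
  have [measurable]: "(\<lambda>x. dist x s) \<in> borel_measurable borel"
    by (intro borel_measurable_continuous_onI continuous_intros)
  have norm: "bl_norm UNIV dist ?g \<le> 1"
  proof (rule bl_norm_le_1_I[of _ _ "1/2" _ "1/2"])
    show "\<bar>?g x - ?g y\<bar> \<le> 1 / 2 * dist x y" for x y
      using dist_triangle[of x s y] dist_triangle[of y s x] dist_commute[of x y]
      by (auto simp: min_def abs_if)
  qed auto
  have int: "integrable \<mu> ?g"
    by (rule integrable_const_bound[of _ 1]) auto
  have "(\<integral>x. ?g x \<partial>\<mu>) \<noteq> 0"
  proof
    assume "(\<integral>x. ?g x \<partial>\<mu>) = 0"
    then have "AE x in \<mu>. ?g x = 0"
      using int by (subst (asm) integral_nonneg_eq_0_iff_AE) auto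
    then have AE: "AE x in \<mu>. x = s"
      by eventually_elim (auto simp: min_def split: if_splits)
    have "\<mu> = return borel s"
    proof (rule measure_eqI)
      fix A assume A: "A \<in> sets \<mu>"
      have "emeasure \<mu> A = emeasure \<mu> (if s \<in> A then UNIV else {})"
        using AE A by (intro emeasure_eq_AE) auto
      also have "\<dots> = emeasure (return borel s) A"
        using A emeasure_space_1 by auto
      finally show "emeasure \<mu> A = emeasure (return borel s) A" .
    qed simp
    with assms(2) show False by contradiction
  qed
  moreover have "(\<integral>x. ?g x \<partial>return borel s) = 0"
    by (simp add: integral_return)
  ultimately have "0 < \<bar>(\<integral>x. ?g x \<partial>\<mu>) - (\<integral>x. ?g x \<partial>return borel s)\<bar>"
    by (simp only: diff_zero zero_less_abs_iff not_False_eq_True)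
  also have "\<dots> \<le> bl_dist UNIV dist \<mu> (return borel s)"
    by (rule integral_diff_le_bl_dist[OF _ _ _ _ norm])
       (auto simp: prob_space_axioms prob_space_return)
  finally show ?thesis .
qed

section \<open>Prohorov convergence and integrals of Lipschitz functions\<close>

text \<open>
  A sum of level sets approximates a function with values in the unit interval up to \<open>1 / N\<close>;
  the two index sets \<open>{1..N}\<close> and \<open>{..<N}\<close> give the bounds from below and from above.
\<close>

lemma level_set_sums:
  fixes t :: real and N :: nat
  assumes "0 \<le> t" "t \<le> 1" "1 \<le> N"
  shows "t \<le> 1 / N + (\<Sum>k\<in>{1..N}. of_bool (k / N \<le> t)) / N"
    and "(\<Sum>k<N. of_bool (k / N \<le> t)) / N \<le> 1 / N + t"
proof -
  define q where "q = nat \<lfloor>N * t\<rfloor>"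
  have N: "0 < real N" using assms by simp
  have q: "real q \<le> N * t" "N * t < real q + 1"
    using assms unfolding q_def by (auto simp: of_nat_nat)
  have iff: "real k / N \<le> t \<longleftrightarrow> k \<le> q" for k
  proof -
    have "real k / N \<le> t \<longleftrightarrow> real k \<le> N * t"
      using N by (simp add: divide_le_eq mult.commute)
    also have "\<dots> \<longleftrightarrow> k \<le> q"
      using q by linarith
    finally show ?thesis .
  qed
  have "real q \<le> N * 1" using q(1) mult_left_mono[OF assms(2), of "real N"] by linarith
  then have "q \<le> N" by simp
  then have "{1..N} \<inter> {k. k \<le> q} = {1..q}" by auto
  then have "(\<Sum>k\<in>{1..N}. of_bool (k / N \<le> t)) = real q"
    unfolding iff by (simp add: of_bool_def sum.If_cases)
  then show "t \<le> 1 / N + (\<Sum>k\<in>{1..N}. of_bool (k / N \<le> t)) / N"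
    using q N by (simp add: field_simps)
  have "card ({..<N} \<inter> {k. k \<le> q}) \<le> card {..q}"
    by (intro card_mono) auto
  then have "(\<Sum>k<N. of_bool (k / N \<le> t)) \<le> real q + 1"
    unfolding iff by (simp add: of_bool_def sum.If_cases)
  then show "(\<Sum>k<N. of_bool (k / N \<le> t)) / N \<le> 1 / N + t"
    using q N by (simp add: field_simps)
qed

text \<open>
  Enlarging a level set \<open>{h \<ge> k / N}\<close> by \<open>\<epsilon>\<close> with \<open>L * \<epsilon> \<le> 1 / N\<close> stays inside
  \<open>{h \<ge> (k - 1) / N}\<close>, so a Prohorov bound compares the two level set sums termwise.
\<close>

lemma integral_le_of_prohorov_bound:
  fixes h :: "'a::metric_space \<Rightarrow> real" and N :: nat
  assumes \<mu>: "\<mu> \<in> borel_prob_measures" and \<nu>: "\<nu> \<in> borel_prob_measures"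
    and h: "\<And>x. 0 \<le> h x" "\<And>x. h x \<le> 1" "\<And>x y. \<bar>h x - h y\<bar> \<le> L * dist x y"
    and N: "1 \<le> N" and \<epsilon>: "0 \<le> L" "L * \<epsilon> \<le> 1 / N"
    and bound: "\<And>A. A \<in> sets borel \<Longrightarrow> measure \<mu> A \<le> measure \<nu> (\<Union>x\<in>A. ball x \<epsilon>) + \<epsilon>"
  shows "(\<integral>x. h x \<partial>\<mu>) \<le> (\<integral>x. h x \<partial>\<nu>) + 2 / N + \<epsilon>"
proof -
  from \<mu> interpret M: prob_space \<mu> by (simp add: space_prob_algebra)
  from \<nu> interpret V: prob_space \<nu> by (simp add: space_prob_algebra)
  have [measurable_cong, simp]: "sets \<mu> = sets borel" "sets \<nu> = sets borel"
    using \<mu> \<nu> by (auto simp: space_prob_algebra)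
  have [simp]: "space \<mu> = UNIV" "space \<nu> = UNIV"
    using sets_eq_imp_space_eq[of \<mu> borel] sets_eq_imp_space_eq[of \<nu> borel] by auto
  have [simp]: "measure \<mu> UNIV = 1" "measure \<nu> UNIV = 1"
    using M.prob_space V.prob_space by simp_all
  have N0: "0 < real N" using N by simp
  have "L-lipschitz_on UNIV h"
    using h(3) \<epsilon>(1) by (intro lipschitz_onI) (auto simp: dist_real_def)
  then have hm [measurable]: "h \<in> borel_measurable borel"
    by (intro borel_measurable_continuous_onI lipschitz_on_continuous_on)
  define A where "A k = {x. k / N \<le> h x}" for k :: nat
  have A [measurable]: "A k \<in> sets borel" for k
    unfolding A_def by measurable
  have of_bool: "of_bool (k / N \<le> h x) = (indicator (A k) x :: real)" for k x
    by (auto simp: A_def)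
  have int\<mu>: "integrable \<mu> h"
    by (rule M.integrable_const_bound[of _ 1]) (simp_all add: h abs_of_nonneg)
  have int\<nu>: "integrable \<nu> h"
    by (rule V.integrable_const_bound[of _ 1]) (simp_all add: h abs_of_nonneg)
  have sumM: "integrable \<mu> (\<lambda>x. \<Sum>k\<in>K. indicator (A k) x :: real)" for K
    by (intro Bochner_Integration.integrable_sum integrable_real_indicator) (auto simp: less_top[symmetric])
  have sumV: "integrable \<nu> (\<lambda>x. \<Sum>k\<in>K. indicator (A k) x :: real)" for K
    by (intro Bochner_Integration.integrable_sum integrable_real_indicator) (auto simp: less_top[symmetric])
  have "(\<integral>x. h x \<partial>\<mu>) \<le> (\<integral>x. 1 / N + (\<Sum>k\<in>{1..N}. indicator (A k) x) / N \<partial>\<mu>)"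
    using level_set_sums(1)[OF h(1) h(2) N] sumM
    by (intro integral_mono int\<mu>) (auto simp: of_bool)
  also have "\<dots> = 1 / N + (\<Sum>k\<in>{1..N}. measure \<mu> (A k)) / N"
    using sumM
    by (subst Bochner_Integration.integral_add)
       (auto simp: Bochner_Integration.integral_sum less_top[symmetric])
  also have "(\<Sum>k\<in>{1..N}. measure \<mu> (A k)) = (\<Sum>k<N. measure \<mu> (A (Suc k)))"
    using sum.atLeast1_atMost_eq[of "\<lambda>k. measure \<mu> (A k)" N] by simp
  also have "\<dots> \<le> (\<Sum>k<N. measure \<nu> (A k) + \<epsilon>)"
  proof (rule sum_mono)
    fix k
    have "(\<Union>x\<in>A (Suc k). ball x \<epsilon>) \<subseteq> A k"
    proof safe
      fix x y assume xy: "x \<in> A (Suc k)" "y \<in> ball x \<epsilon>"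
      then have "\<bar>h x - h y\<bar> \<le> L * \<epsilon>"
        using h(3)[of x y] mult_left_mono[of "dist x y" \<epsilon> L] \<epsilon>(1) by auto
      then have "\<bar>h x - h y\<bar> \<le> 1 / N" using \<epsilon>(2) by simp
      with xy(1) show "y \<in> A k"
        by (simp add: A_def add_divide_distrib)
    qed
    then have "measure \<nu> (\<Union>x\<in>A (Suc k). ball x \<epsilon>) \<le> measure \<nu> (A k)"
      by (intro V.finite_measure_mono) auto
    with bound[OF A, of "Suc k"] show "measure \<mu> (A (Suc k)) \<le> measure \<nu> (A k) + \<epsilon>" by simp
  qed
  also have "1 / N + \<dots> / N = 1 / N + (\<Sum>k<N. measure \<nu> (A k)) / N + \<epsilon>"
    using N0 by (simp add: sum.distrib field_simps)
  also have "(\<Sum>k<N. measure \<nu> (A k)) / N = (\<integral>x. (\<Sum>k<N. indicator (A k) x) / N \<partial>\<nu>)"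
    by (simp add: Bochner_Integration.integral_sum less_top[symmetric])
  also have "\<dots> \<le> (\<integral>x. 1 / N + h x \<partial>\<nu>)"
    using level_set_sums(2)[OF h(1) h(2) N] sumV int\<nu>
    by (intro integral_mono) (auto simp: of_bool)
  also have "\<dots> = 1 / N + (\<integral>x. h x \<partial>\<nu>)"
    using int\<nu> by simp
  finally show ?thesis
    using N0 by (simp add: divide_right_mono)
qed

text \<open>
  Both one-sided estimates follow from the same asymmetric bound, the lower one by passing to
  \<open>1 - h\<close>.
\<close>

lemma integral_tendsto_of_prohorov_dist:
  fixes h :: "'a::metric_space \<Rightarrow> real"
  assumes \<mu>: "\<And>n. 1 \<le> n \<Longrightarrow> \<mu> n \<in> borel_prob_measures" and \<nu>: "\<nu> \<in> borel_prob_measures"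
    and h: "\<And>x. 0 \<le> h x" "\<And>x. h x \<le> 1" "\<And>x y. \<bar>h x - h y\<bar> \<le> L * dist x y"
    and L: "0 \<le> L"
    and lim: "(\<lambda>n. prohorov_dist (\<mu> n) \<nu>) \<longlonglongrightarrow> 0"
  shows "(\<lambda>n. \<integral>x. h x \<partial>\<mu> n) \<longlonglongrightarrow> (\<integral>x. h x \<partial>\<nu>)"
proof (rule LIMSEQ_I)
  fix r :: real assume r: "0 < r"
  obtain N :: nat where N: "3 / r < N" using reals_Archimedean2 by blast
  have "0 < 3 / r" using r by simp
  with N have "0 < real N" by linarith
  then have N1: "1 \<le> N" "3 / N < r" using N r by (auto simp: field_simps)
  define e where "e = 1 / (N * (L + 1))"
  have e: "0 < e" "e \<le> 1 / N" "L * e \<le> 1 / N"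
  proof -
    have N0: "0 < real N" using N1 by simp
    then show "0 < e" using L by (simp add: e_def)
    have "1 / (L + 1) \<le> 1" "L / (L + 1) \<le> 1"
      using L by (simp_all add: divide_le_eq_1)
    from this[THEN divide_right_mono, of "real N"]
    show "e \<le> 1 / N" "L * e \<le> 1 / N"
      by (simp_all add: e_def mult.commute)
  qed
  have "eventually (\<lambda>n. prohorov_dist (\<mu> n) \<nu> < e) sequentially"
    using order_tendstoD(2)[OF lim e(1)] .
  then have "eventually (\<lambda>n. 1 \<le> n \<and> prohorov_dist (\<mu> n) \<nu> < e) sequentially"
    using eventually_ge_at_top[of 1] by eventually_elim auto
  then obtain n0 where n0: "\<And>n. n0 \<le> n \<Longrightarrow> 1 \<le> n \<and> prohorov_dist (\<mu> n) \<nu> < e"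
    by (auto simp: eventually_sequentially)
  show "\<exists>no. \<forall>n\<ge>no. norm ((\<integral>x. h x \<partial>\<mu> n) - (\<integral>x. h x \<partial>\<nu>)) < r"
  proof (intro exI[of _ n0] allI impI)
    fix n assume "n0 \<le> n"
    from n0[OF this] have n: "1 \<le> n" "prohorov_dist (\<mu> n) \<nu> < e" by auto
    note \<mu>n = \<mu>[OF n(1)]
    from \<mu>n interpret M: prob_space "\<mu> n" by (simp add: space_prob_algebra)
    from \<nu> interpret V: prob_space \<nu> by (simp add: space_prob_algebra)
    have [measurable_cong, simp]: "sets (\<mu> n) = sets borel" "sets \<nu> = sets borel"
      using \<mu>n \<nu> by (auto simp: space_prob_algebra)
    let ?E = "{\<epsilon>. \<epsilon> > 0 \<and>
      (\<forall>A \<in> sets borel. measure (\<mu> n) A \<le> measure \<nu> (\<Union>x\<in>A. ball x \<epsilon>) + \<epsilon>)}"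
    \<comment> \<open>The infimum is over a nonempty set, so a value below \<open>e\<close> yields an admissible \<open>\<epsilon> < e\<close>.\<close>
    have "1 \<in> ?E" by (auto intro: add_increasing M.prob_le_1)
    then have "?E \<noteq> {}" by blast
    from cInf_lessD[OF this] n(2) obtain \<epsilon> where \<epsilon>: "0 < \<epsilon>" "\<epsilon> < e"
      "\<And>A. A \<in> sets borel \<Longrightarrow> measure (\<mu> n) A \<le> measure \<nu> (\<Union>x\<in>A. ball x \<epsilon>) + \<epsilon>"
      unfolding prohorov_dist_def by blast
    have L\<epsilon>: "L * \<epsilon> \<le> 1 / N"
      using e(3) mult_left_mono[of \<epsilon> e L] L \<epsilon>(2) by simp
    have "L-lipschitz_on UNIV h"
      using h(3) L by (intro lipschitz_onI) (auto simp: dist_real_def)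
    then have hm [measurable]: "h \<in> borel_measurable borel"
      by (intro borel_measurable_continuous_onI lipschitz_on_continuous_on)
    have int: "integrable (\<mu> n) h" "integrable \<nu> h"
      by (rule M.integrable_const_bound[of _ 1] V.integrable_const_bound[of _ 1];
          simp add: h abs_of_nonneg)+
    have "(\<integral>x. h x \<partial>\<mu> n) \<le> (\<integral>x. h x \<partial>\<nu>) + 2 / N + \<epsilon>"
      by (rule integral_le_of_prohorov_bound[OF \<mu>n \<nu> h N1(1) L L\<epsilon> \<epsilon>(3)])
    moreover have "(\<integral>x. 1 - h x \<partial>\<mu> n) \<le> (\<integral>x. 1 - h x \<partial>\<nu>) + 2 / N + \<epsilon>"
    proof (rule integral_le_of_prohorov_bound[OF \<mu>n \<nu> _ _ _ N1(1) L L\<epsilon> \<epsilon>(3)])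
      show "\<bar>(1 - h x) - (1 - h y)\<bar> \<le> L * dist x y" for x y
        using h(3)[of x y] by simp
    qed (auto simp: h)
    ultimately have "\<bar>(\<integral>x. h x \<partial>\<mu> n) - (\<integral>x. h x \<partial>\<nu>)\<bar> \<le> 2 / N + \<epsilon>"
      using int by (simp add: M.prob_space V.prob_space)
    also have "\<dots> \<le> 3 / N" using \<epsilon>(2) e(2) by (simp add: field_simps)
    also have "\<dots> < r" by fact
    finally show "norm ((\<integral>x. h x \<partial>\<mu> n) - (\<integral>x. h x \<partial>\<nu>)) < r" by simp
  qed
qed

section \<open>Empirical measures and resampling\<close>

abbreviation sample_algebra :: "nat \<Rightarrow> (nat \<Rightarrow> 'z::topological_space) measure" where
  "sample_algebra n \<equiv> PiM {..<n} (\<lambda>_. borel)"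

lemma empirical_eq_distr:
  assumes "1 \<le> n"
  shows "empirical n z = distr (measure_pmf (pmf_of_set {..<n})) borel z"
proof -
  let ?D = "distr (measure_pmf (pmf_of_set {..<n})) borel z"
  have ne: "{..<n} \<noteq> {}" using assms by (auto simp: lessThan_empty_iff)
  have "empirical n z = measure_of (space ?D) (sets ?D) (emeasure ?D)"
    unfolding empirical_def space_distr space_borel sets_distr
  proof (rule measure_of_eq)
    fix A :: "'a set" assume "A \<in> sigma_sets UNIV (sets borel)"
    then have A: "A \<in> sets borel"
      by (metis sets.sigma_sets_eq space_borel)
    have "(\<Sum>i<n. emeasure (return borel (z i)) A) = of_nat (card ({..<n} \<inter> z -` A))"
      using A by (simp add: indicator_def sum.If_cases vimage_def)
    moreover have "emeasure ?D A = ennreal (card ({..<n} \<inter> z -` A) / n)"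
      using A ne by (simp add: emeasure_distr emeasure_pmf_of_set)
    moreover have "1 / of_nat n * c = c / of_nat n" for c :: ennreal
      by (metis ennreal_times_divide mult.commute mult.right_neutral)
    ultimately show "1 / of_nat n * (\<Sum>i<n. emeasure (return borel (z i)) A) = emeasure ?D A"
      using assms
      by (simp add: divide_ennreal[symmetric] ennreal_of_nat_eq_real_of_nat)
  qed simp
  then show ?thesis by (simp only: measure_of_of_measure)
qed

lemma empirical_in_prob_measures:
  "1 \<le> n \<Longrightarrow> empirical n z \<in> borel_prob_measures"
  by (auto simp: space_prob_algebra empirical_eq_distr
      intro!: prob_space.prob_space_distr prob_space_measure_pmf)

lemma integral_empirical:
  fixes h :: "'z::topological_space \<Rightarrow> real"
  assumes "1 \<le> n" "h \<in> borel_measurable borel"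
  shows "(\<integral>x. h x \<partial>empirical n z) = (\<Sum>i<n. h (z i)) / n"
proof -
  have "{..<n} \<noteq> {}" using assms by (auto simp: lessThan_empty_iff)
  with assms show ?thesis
    by (simp add: empirical_eq_distr integral_distr integral_pmf_of_set)
qed

text \<open>
  Drawing \<open>n\<close> times from an empirical measure amounts to drawing one of the \<open>n ^ n\<close> index
  functions uniformly. This finite description makes integrals with respect to \<open>resample n z\<close>
  finite sums, from which measurability and continuity in \<open>z\<close> can be read off.
\<close>

lemma resample_eq_distr:
  fixes z :: "nat \<Rightarrow> 'z::topological_space"
  assumes "1 \<le> n"
  shows "resample n z = distr (measure_pmf (pmf_of_set ({..<n} \<rightarrow>\<^sub>E {..<n}))) (sample_algebra n)
    (\<lambda>j. \<lambda>i\<in>{..<n}. z (j i))"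
proof -
  let ?J = "{..<n} \<rightarrow>\<^sub>E {..<n}"
  let ?D = "distr (measure_pmf (pmf_of_set ?J)) (sample_algebra n) (\<lambda>j. \<lambda>i\<in>{..<n}. z (j i))"
  have ne: "{..<n} \<noteq> {}" using assms by (auto simp: lessThan_empty_iff)
  have J: "?J \<noteq> {}" "finite ?J" "card ?J = n ^ n"
    using ne by (auto simp: PiE_eq_empty_iff finite_PiE card_PiE)
  have meas: "(\<lambda>j. \<lambda>i\<in>{..<n}. z (j i)) \<in> measurable (measure_pmf (pmf_of_set ?J)) (sample_algebra n)"
    by (auto simp: space_PiM)
  interpret E: prob_space "empirical n z"
    using empirical_in_prob_measures[OF assms, of z] by (simp add: space_prob_algebra)
  interpret product_prob_space "\<lambda>_. empirical n z" "{..<n}" by unfold_locales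
  have setsE [simp]: "sets (empirical n z) = sets borel"
    using empirical_in_prob_measures[OF assms, of z] by (simp add: space_prob_algebra)
  have "?D = PiM {..<n} (\<lambda>_. empirical n z)"
  proof (rule PiM_eqI)
    show "sets ?D = sets (PiM {..<n} (\<lambda>_. empirical n z))"
      by (simp cong: sets_PiM_cong)
    fix A assume A: "\<And>i. i \<in> {..<n} \<Longrightarrow> A i \<in> sets (empirical n z)"
    then have "Pi\<^sub>E {..<n} A \<in> sets (sample_algebra n)"
      by (intro sets_PiM_I_finite) auto
    then have "emeasure ?D (Pi\<^sub>E {..<n} A)
        = card (?J \<inter> (\<lambda>j. \<lambda>i\<in>{..<n}. z (j i)) -` Pi\<^sub>E {..<n} A) / card ?J"
      using J by (simp add: emeasure_distr[OF meas] emeasure_pmf_of_set)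
    also have "?J \<inter> (\<lambda>j. \<lambda>i\<in>{..<n}. z (j i)) -` Pi\<^sub>E {..<n} A
        = (\<Pi>\<^sub>E i\<in>{..<n}. {..<n} \<inter> z -` A i)"
      by (auto simp: PiE_iff)
    also have "ennreal (card (\<Pi>\<^sub>E i\<in>{..<n}. {..<n} \<inter> z -` A i) / card ?J)
        = ennreal (\<Prod>i<n. card ({..<n} \<inter> z -` A i) / n)"
      by (simp add: J card_PiE prod_dividef)
    also have "\<dots> = (\<Prod>i<n. ennreal (card ({..<n} \<inter> z -` A i) / n))"
      by (rule prod_ennreal[symmetric]) simp
    also have "\<dots> = (\<Prod>i<n. emeasure (empirical n z) (A i))"
    proof (rule prod.cong)
      fix i assume "i \<in> {..<n}"
      then have "A i \<in> sets borel" using A by simp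
      then show "ennreal (card ({..<n} \<inter> z -` A i) / n) = emeasure (empirical n z) (A i)"
        using ne unfolding empirical_eq_distr[OF assms]
        by (simp add: emeasure_distr emeasure_pmf_of_set)
    qed simp
    finally show "emeasure ?D (Pi\<^sub>E {..<n} A) = (\<Prod>i<n. emeasure (empirical n z) (A i))" .
  qed simp
  then show ?thesis by (simp add: resample_def)
qed

lemma sets_resample: "1 \<le> n \<Longrightarrow> sets (resample n z) = sets (sample_algebra n)"
  by (simp add: resample_eq_distr)

lemma prob_space_resample: "1 \<le> n \<Longrightarrow> prob_space (resample n z)"
  unfolding resample_eq_distr
  by (intro prob_space.prob_space_distr prob_space_measure_pmf) (auto simp: space_PiM)

lemma integral_resample:
  fixes F :: "(nat \<Rightarrow> 'z::topological_space) \<Rightarrow> real"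
  assumes "1 \<le> n" "F \<in> borel_measurable (sample_algebra n)"
  shows "(\<integral>w. F w \<partial>resample n z)
    = (\<Sum>j\<in>{..<n} \<rightarrow>\<^sub>E {..<n}. F (\<lambda>i\<in>{..<n}. z (j i))) / n ^ n"
proof -
  let ?J = "{..<n} \<rightarrow>\<^sub>E {..<n}"
  have "{..<n} \<noteq> {}" using assms by (auto simp: lessThan_empty_iff)
  then have J: "?J \<noteq> {}" "finite ?J" "card ?J = n ^ n"
    by (auto simp: PiE_eq_empty_iff finite_PiE card_PiE)
  have meas: "(\<lambda>j. \<lambda>i\<in>{..<n}. z (j i)) \<in> measurable (measure_pmf (pmf_of_set ?J)) (sample_algebra n)"
    by (auto simp: space_PiM)
  show ?thesis
    by (simp add: resample_eq_distr[OF assms(1)] integral_distr[OF meas assms(2)] integral_pmf_of_set J)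
qed

lemma measurable_restrict_reindex:
  assumes "j \<in> {..<n} \<rightarrow>\<^sub>E {..<n}"
  shows "(\<lambda>z. \<lambda>i\<in>{..<n}. z (j i)) \<in> measurable (sample_algebra n) (sample_algebra n)"
  using assms by (intro measurable_restrict measurable_component_singleton) auto

lemma measurable_resample:
  assumes "1 \<le> n"
  shows "resample n \<in> measurable (sample_algebra n) (subprob_algebra (sample_algebra n))"
proof (rule measurable_subprob_algebra)
  let ?J = "{..<n} \<rightarrow>\<^sub>E {..<n}"
  fix A :: "(nat \<Rightarrow> 'a) set" assume A [measurable]: "A \<in> sets (sample_algebra n)"
  have "(\<lambda>z. (\<Sum>j\<in>?J. indicator A (\<lambda>i\<in>{..<n}. z (j i)) :: real) / n ^ n)
      \<in> borel_measurable (sample_algebra n)"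
    by (intro borel_measurable_divide borel_measurable_const borel_measurable_sum
        measurable_compose[OF measurable_restrict_reindex] borel_measurable_indicator A)
  then have "(\<lambda>z. \<integral>w. indicator A w \<partial>resample n z :: real) \<in> borel_measurable (sample_algebra n)"
    by (simp only: integral_resample[OF assms borel_measurable_indicator[OF A]])
  moreover have "emeasure (resample n z) A = ennreal (\<integral>w. indicator A w \<partial>resample n z)" for z
  proof -
    interpret prob_space "resample n z" by (rule prob_space_resample[OF assms])
    have "A \<in> sets (resample n z)" by (simp add: sets_resample[OF assms])
    then show ?thesis by (simp add: emeasure_eq_measure sets.Int_space_eq2)
  qed
  ultimately show "(\<lambda>z. emeasure (resample n z) A) \<in> borel_measurable (sample_algebra n)"
    by simp
qed (use assms in \<open>auto simp: sets_resample intro!: prob_space_imp_subprob_space intro: prob_space_resample[OF assms]\<close>)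

text \<open>
  The weak law of large numbers in mean. The bound depends neither on the law \<open>M\<close> nor on \<open>h\<close>;
  this uniformity allows it to be applied to every realization of a random empirical measure.
  It follows from the second moment \<open>\<integral>Y\<^sup>2 \<le> 1 / n\<close> of the mean \<open>Y\<close> of the centred variables and
  \<open>2 * \<bar>Y\<bar> \<le> sqrt n * Y\<^sup>2 + 1 / sqrt n\<close>.
\<close>

lemma mean_deviation_le:
  fixes h :: "'a \<Rightarrow> real"
  assumes M: "prob_space M" and [measurable]: "h \<in> borel_measurable M"
    and h: "\<And>x. 0 \<le> h x" "\<And>x. h x \<le> 1" and n: "1 \<le> (n::nat)"
  shows "(\<integral>z. \<bar>(\<Sum>i<n. h (z i)) / n - (\<integral>x. h x \<partial>M)\<bar> \<partial>PiM {..<n} (\<lambda>_. M)) \<le> 1 / sqrt n"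
proof -
  interpret M: prob_space M by fact
  interpret product_prob_space "\<lambda>_. M" "{..<n}" by unfold_locales
  let ?P = "PiM {..<n} (\<lambda>_. M)"
  have n0: "0 < real n" using n by simp
  define c where "c = (\<integral>x. h x \<partial>M)"
  define X where "X x = h x - c" for x
  define Y where "Y z = (\<Sum>i<n. X (z i)) / n" for z
  have [measurable]: "X \<in> borel_measurable M" unfolding X_def by measurable
  have inth: "integrable M h"
    by (rule M.integrable_const_bound[of _ 1]) (simp_all add: h abs_of_nonneg)
  have c: "0 \<le> c" "c \<le> 1"
  proof -
    show "0 \<le> c" unfolding c_def by (rule Bochner_Integration.integral_nonneg) (simp add: h)
    have "c \<le> (\<integral>x. 1 \<partial>M)" unfolding c_def using inth by (intro integral_mono) (auto simp: h)
    then show "c \<le> 1" by (simp add: M.prob_space)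
  qed
  have X: "\<bar>X x\<bar> \<le> 1" for x
    using h(1)[of x] h(2)[of x] c by (auto simp: X_def)
  have intX: "integrable M X"
    by (rule M.integrable_const_bound[of _ 1]) (simp_all add: X)
  have X0: "(\<integral>x. X x \<partial>M) = 0"
    using inth by (simp add: X_def c_def M.prob_space)
  have XX: "\<bar>X x * X y\<bar> \<le> 1" for x y
    using mult_mono[OF X X] by (simp add: abs_mult)
  have meas: "(\<lambda>z. X (z i)) \<in> borel_measurable ?P" if "i < n" for i
    using that by (intro measurable_compose[OF measurable_component_singleton]) auto
  have int2: "integrable ?P (\<lambda>z. X (z i) * X (z j))" if "i < n" "j < n" for i j
    using meas[OF that(1)] meas[OF that(2)]
    by (intro P.integrable_const_bound[of _ 1]) (simp_all add: XX)
  have cov: "(\<integral>z. X (z i) * X (z j) \<partial>?P) \<le> of_bool (i = j)" if "i < n" "j < n" for i j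
  proof (cases "i = j")
    case True
    have "(\<integral>z. X (z i) * X (z j) \<partial>?P) \<le> (\<integral>z. 1 \<partial>?P)"
      by (intro integral_mono int2 that) (auto intro: order_trans[OF abs_ge_self XX])
    with True show ?thesis by (simp add: P.prob_space)
  next
    case False
    \<comment> \<open>Padded with factors 1, the product of two coordinates is a product over all of them, and one
      of its factors has mean 0.\<close>
    let ?f = "\<lambda>k x. if k \<in> {i, j} then X x else 1"
    have prod: "(\<Prod>k<n. if k \<in> {i, j} then g k else 1) = g i * g j" for g :: "nat \<Rightarrow> real"
    proof -
      have "(\<Prod>k<n. if k \<in> {i, j} then g k else 1) = (\<Prod>k\<in>{..<n} \<inter> {i, j}. g k)"
        by (rule prod.inter_restrict[symmetric]) simp
      also have "{..<n} \<inter> {i, j} = {i, j}" using that by auto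
      also have "(\<Prod>k\<in>{i, j}. g k) = g i * g j" using False by simp
      finally show ?thesis .
    qed
    have "(\<integral>z. X (z i) * X (z j) \<partial>?P) = (\<integral>z. (\<Prod>k<n. ?f k (z k)) \<partial>?P)"
      using prod[of "\<lambda>k. X (_ k)"] by (simp only: prod)
    also have "\<dots> = (\<Prod>k<n. \<integral>x. ?f k x \<partial>M)"
    proof (rule product_integral_prod)
      show "integrable M (?f k)" for k
        using intX by (cases "k \<in> {i, j}") auto
    qed simp
    also have "\<dots> = 0"
      using that(1) by (intro prod_zero) (auto simp: X0 intro!: bexI[of _ i])
    finally show ?thesis by simp
  qed
  have Y2: "(Y z)\<^sup>2 = (\<Sum>i<n. \<Sum>j<n. X (z i) * X (z j)) / (real n)\<^sup>2" for z
    by (simp add: Y_def power2_eq_square sum_product)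
  have intY2: "integrable ?P (\<lambda>z. (Y z)\<^sup>2)"
    unfolding Y2 by (intro integrable_divide Bochner_Integration.integrable_sum int2) auto
  have "(\<integral>z. (Y z)\<^sup>2 \<partial>?P) = (\<Sum>i<n. \<Sum>j<n. \<integral>z. X (z i) * X (z j) \<partial>?P) / (real n)\<^sup>2"
  proof -
    have "(\<integral>z. (\<Sum>i<n. \<Sum>j<n. X (z i) * X (z j)) \<partial>?P)
        = (\<Sum>i<n. \<integral>z. (\<Sum>j<n. X (z i) * X (z j)) \<partial>?P)"
      by (intro Bochner_Integration.integral_sum Bochner_Integration.integrable_sum int2) auto
    also have "\<dots> = (\<Sum>i<n. \<Sum>j<n. \<integral>z. X (z i) * X (z j) \<partial>?P)"
      by (intro sum.cong refl Bochner_Integration.integral_sum int2) auto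
    finally show ?thesis unfolding Y2 by simp
  qed
  also have "\<dots> \<le> (\<Sum>i<n. \<Sum>j<n. of_bool (i = j)) / (real n)\<^sup>2"
    by (intro divide_right_mono sum_mono cov) auto
  also have "(\<Sum>i<n. \<Sum>j<n. of_bool (i = j)) = real n"
    by (simp add: of_bool_def)
  finally have second: "(\<integral>z. (Y z)\<^sup>2 \<partial>?P) \<le> 1 / n"
    using n0 by (simp add: power2_eq_square)
  have amgm: "\<bar>y\<bar> \<le> (sqrt n * y\<^sup>2 + 1 / sqrt n) / 2" for y :: real
  proof -
    have s: "0 < sqrt n" using n0 by simp
    have "0 \<le> (sqrt n * \<bar>y\<bar> - 1)\<^sup>2 / sqrt n" using s by simp
    also have "\<dots> = sqrt n * y\<^sup>2 + 1 / sqrt n - 2 * \<bar>y\<bar>"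
      using s by (simp add: power2_eq_square field_simps)
    finally show ?thesis by simp
  qed
  have Y_eq: "(\<Sum>i<n. h (z i)) / n - c = Y z" for z
    using n0 by (simp add: Y_def X_def sum_subtractf diff_divide_distrib)
  have "(\<integral>z. \<bar>Y z\<bar> \<partial>?P) \<le> (\<integral>z. (sqrt n * (Y z)\<^sup>2 + 1 / sqrt n) / 2 \<partial>?P)"
  proof (rule integral_mono')
    show "integrable ?P (\<lambda>z. (sqrt n * (Y z)\<^sup>2 + 1 / sqrt n) / 2)"
      using intY2 by simp
  qed (rule amgm, simp)
  also have "\<dots> = (sqrt n * (\<integral>z. (Y z)\<^sup>2 \<partial>?P) + 1 / sqrt n) / 2"
    using intY2 by (simp add: P.prob_space)
  also have "\<dots> \<le> (sqrt n * (1 / n) + 1 / sqrt n) / 2"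
    using second by (intro divide_right_mono add_right_mono mult_left_mono) auto
  also have "\<dots> = 1 / sqrt n"
    using n0 by (simp add: real_div_sqrt field_simps)
  finally show ?thesis
    unfolding c_def[symmetric] Y_eq .
qed

section \<open>Continuity and measurability on the sample space\<close>

text \<open>
  Points of the finite product are extensional, so restriction to \<open>{..<n}\<close> reduces this to the full
  sequence space, where the Borel sets of the product topology form the product algebra.
\<close>

lemma openin_product_imp_sets:
  fixes U :: "(nat \<Rightarrow> 'z::second_countable_topology) set"
  assumes "openin (product_topology (\<lambda>_. euclidean) {..<n}) U"
  shows "U \<in> sets (sample_algebra n)"
proof -
  let ?X = "product_topology (\<lambda>_. euclidean :: 'z topology) {..<n}"
  have "continuous_map (product_topology (\<lambda>_. euclidean) UNIV) ?X (\<lambda>\<omega>. restrict \<omega> {..<n})"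
    unfolding continuous_map_componentwise by (auto intro: continuous_map_product_projection)
  then have "continuous_map euclidean ?X (\<lambda>\<omega>. restrict \<omega> {..<n})"
    by (simp only: euclidean_product_topology)
  from openin_continuous_map_preimage[OF this assms]
  have "open {\<omega> :: nat \<Rightarrow> 'z. restrict \<omega> {..<n} \<in> U}" by simp
  then have "{\<omega> :: nat \<Rightarrow> 'z. restrict \<omega> {..<n} \<in> U} \<in> sets (PiM UNIV (\<lambda>_. borel))"
    by (simp add: sets_PiM_equal_borel)
  moreover have "(\<lambda>z i. if i < n then z i else undefined)
      \<in> measurable (sample_algebra n) (PiM UNIV (\<lambda>_. borel :: 'z measure))"
  proof (intro measurable_PiM_single')
    show "(\<lambda>z. if i < n then z i else undefined) \<in> borel_measurable (sample_algebra n)" for i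
      by (cases "i < n") auto
  qed auto
  ultimately have "(\<lambda>z i. if i < n then z i else undefined) -` {\<omega>. restrict \<omega> {..<n} \<in> U}
      \<inter> space (sample_algebra n) \<in> sets (sample_algebra n :: (nat \<Rightarrow> 'z) measure)"
    by (rule measurable_sets[rotated])
  also have "(\<lambda>z i. if i < n then z i else undefined) -` {\<omega>. restrict \<omega> {..<n} \<in> U}
      \<inter> space (sample_algebra n) = U"
  proof -
    have eq: "restrict (\<lambda>i. if i < n then z i else undefined) {..<n} = z"
      if "z \<in> extensional {..<n}" for z :: "nat \<Rightarrow> 'z"
      using that by (auto simp: restrict_def extensional_def)
    have "U \<subseteq> extensional {..<n}"
      using openin_subset[OF assms] by (auto simp: PiE_def)
    then show ?thesis by (auto simp: space_PiM PiE_def eq)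
  qed
  finally show ?thesis .
qed

lemma continuous_map_imp_measurable_sample:
  fixes T :: "(nat \<Rightarrow> 'z::second_countable_topology) \<Rightarrow> 'h::topological_space"
  assumes "continuous_map (product_topology (\<lambda>_. euclidean) {..<n}) euclidean T"
  shows "T \<in> borel_measurable (sample_algebra n)"
proof (rule borel_measurableI)
  fix S :: "'h set" assume "open S"
  then have "openin (product_topology (\<lambda>_. euclidean) {..<n})
      {z \<in> topspace (product_topology (\<lambda>_. euclidean) {..<n}). T z \<in> S}"
    by (intro openin_continuous_map_preimage[OF assms]) simp
  from openin_product_imp_sets[OF this]
  show "T -` S \<inter> space (sample_algebra n) \<in> sets (sample_algebra n)"
    by (simp add: space_PiM vimage_def Int_def conj_commute)
qed

lemma distr_resample_in_prob_measures:
  assumes "1 \<le> n" "T \<in> borel_measurable (sample_algebra n)"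
  shows "distr (resample n z) borel T \<in> borel_prob_measures"
  using assms(2)
  by (simp add: space_prob_algebra prob_space.prob_space_distr[OF prob_space_resample[OF assms(1)]]
      measurable_cong_sets[OF sets_resample[OF assms(1)] refl])

text \<open>
  The map is even continuous for the weak topology: an integral against the resampled law is a
  finite average of the continuous functions \<open>z \<mapsto> g (T (z \<circ> j))\<close>.
\<close>

lemma measurable_distr_resample:
  fixes T :: "(nat \<Rightarrow> 'z::second_countable_topology) \<Rightarrow> 'h::topological_space"
  assumes n: "1 \<le> n"
    and T: "continuous_map (product_topology (\<lambda>_. euclidean) {..<n}) euclidean T"
  shows "(\<lambda>z. distr (resample n z) borel T) \<in> measurable (sample_algebra n) weak_borel"
proof -
  let ?X = "product_topology (\<lambda>_. euclidean :: 'z topology) {..<n}"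
  let ?L = "\<lambda>z. distr (resample n z) borel T"
  note Tm = continuous_map_imp_measurable_sample[OF T]
  note L = distr_resample_in_prob_measures[OF n Tm]
  have cont: "continuous_map ?X euclidean (\<lambda>z. \<integral>x. g x \<partial>?L z)"
    if g: "continuous_on UNIV g" for g :: "'h \<Rightarrow> real"
  proof -
    have gm: "g \<in> borel_measurable borel"
      using g by (rule borel_measurable_continuous_onI)
    have re: "continuous_map ?X ?X (\<lambda>z. \<lambda>i\<in>{..<n}. z (j i))" if "j \<in> {..<n} \<rightarrow>\<^sub>E {..<n}" for j
      using that unfolding continuous_map_componentwise
      by (auto intro!: continuous_map_product_projection)
    have gT: "continuous_map ?X euclidean (\<lambda>z. g (T z))"
      using continuous_map_compose[OF T, of euclidean g] g by (simp add: o_def)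
    have eq: "(\<integral>x. g x \<partial>?L z)
        = (\<Sum>j\<in>{..<n} \<rightarrow>\<^sub>E {..<n}. g (T (\<lambda>i\<in>{..<n}. z (j i)))) / n ^ n" for z
    proof -
      have "(\<integral>x. g x \<partial>?L z) = (\<integral>w. g (T w) \<partial>resample n z)"
        using Tm gm by (intro integral_distr)
          (simp_all add: measurable_cong_sets[OF sets_resample[OF n] refl])
      also have "\<dots> = (\<Sum>j\<in>{..<n} \<rightarrow>\<^sub>E {..<n}. g (T (\<lambda>i\<in>{..<n}. z (j i)))) / n ^ n"
        by (rule integral_resample[OF n measurable_compose[OF Tm gm]])
      finally show ?thesis .
    qed
    show ?thesis
      unfolding eq
      by (intro continuous_map_real_divide continuous_map_sum continuous_map_const[THEN iffD2])
         (use n gT re in \<open>auto simp: finite_PiE intro: continuous_map_compose[OF re gT, unfolded o_def]\<close>)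
  qed
  have "continuous_map ?X weak_topology ?L"
    unfolding weak_topology_def
  proof (rule continuous_on_generated_topo)
    fix U :: "'h measure set"
    assume "U \<in> {{\<mu> \<in> borel_prob_measures. (\<integral>x. f x \<partial>\<mu>) \<in> U} | (f :: 'h \<Rightarrow> real) U.
      continuous_on UNIV f \<and> bounded (range f) \<and> open U}"
    then obtain g :: "'h \<Rightarrow> real" and V
      where g: "U = {\<mu> \<in> borel_prob_measures. (\<integral>x. g x \<partial>\<mu>) \<in> V}"
        "continuous_on UNIV g" "open V" by blast
    have "openin ?X {z \<in> topspace ?X. (\<integral>x. g x \<partial>?L z) \<in> V}"
      using g(3) by (intro openin_continuous_map_preimage[OF cont[OF g(2)]]) simp
    also have "{z \<in> topspace ?X. (\<integral>x. g x \<partial>?L z) \<in> V} = ?L -` U \<inter> topspace ?X"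
      using L by (auto simp: g(1))
    finally show "openin ?X (?L -` U \<inter> topspace ?X)" .
  next
    have "borel_prob_measures \<in> {{\<mu> \<in> borel_prob_measures. (\<integral>x. f x \<partial>\<mu>) \<in> U} | (f :: 'h \<Rightarrow> real) U.
      continuous_on UNIV f \<and> bounded (range f) \<and> open U}"
      by (auto intro!: exI[of _ "\<lambda>_. 0"] exI[of _ UNIV])
    with L show "?L ` topspace ?X \<subseteq> \<Union> {{\<mu> \<in> borel_prob_measures. (\<integral>x. f x \<partial>\<mu>) \<in> U} |
      (f :: 'h \<Rightarrow> real) U. continuous_on UNIV f \<and> bounded (range f) \<and> open U}"
      by blast
  qed
  note cont_L = this
  have top: "topspace (weak_topology :: 'h measure topology) \<subseteq> borel_prob_measures"
    unfolding weak_topology_def topology_generated_by_topspace by auto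
  show ?thesis
    unfolding weak_borel_def
  proof (rule measurable_measure_of)
    show "{U. openin weak_topology U} \<subseteq> Pow (borel_prob_measures :: 'h measure set)"
      using top openin_subset by blast
    show "?L \<in> space (sample_algebra n) \<rightarrow> borel_prob_measures" using L by auto
    fix U :: "'h measure set" assume "U \<in> {U. openin weak_topology U}"
    then have "openin ?X {z \<in> topspace ?X. ?L z \<in> U}"
      by (intro openin_continuous_map_preimage[OF cont_L]) simp
    from openin_product_imp_sets[OF this]
    show "?L -` U \<inter> space (sample_algebra n) \<in> sets (sample_algebra n)"
      by (simp add: space_PiM vimage_def Int_def conj_commute)
  qed
qed

section \<open>Lipschitz partitions of unity\<close>

text \<open>
  A finite family of test functions subordinate to a cover by balls of radius \<open>\<eta>\<close>. Up to an
  error of order \<open>\<eta>\<close> its finitely many integrals determine the bounded Lipschitz distance.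
\<close>

locale lipschitz_partition =
  fixes h :: "nat \<Rightarrow> 'z::metric_space \<Rightarrow> real" and c :: "nat \<Rightarrow> 'z"
    and m :: nat and L \<eta> :: real
  assumes nonneg: "0 \<le> h k x"
    and le_1: "h k x \<le> 1"
    and Lipschitz: "\<bar>h k x - h k y\<bar> \<le> L * dist x y"
    and sum_1: "(\<Sum>k<m. h k x) = 1"
    and support: "h k x \<noteq> 0 \<Longrightarrow> dist x (c k) < \<eta>"
    and L_nonneg: "0 \<le> L"

primrec running_max :: "(nat \<Rightarrow> 'a \<Rightarrow> real) \<Rightarrow> nat \<Rightarrow> 'a \<Rightarrow> real" where
  "running_max \<psi> 0 x = 0"
| "running_max \<psi> (Suc k) x = max (running_max \<psi> k x) (\<psi> k x)"

text \<open>
  The increments of the running maximum of bumps \<open>\<psi> 0, \<psi> 1, \<dots>\<close> around the points of a finite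
  net telescope to its final value, which is 1 since at each point some bump equals 1. They need no
  normalizing denominator, so their Lipschitz constant is immediate.
\<close>

lemma lipschitz_partition_exists:
  fixes \<eta> :: real
  assumes "totally_bounded (UNIV :: 'z::metric_space set)" "0 < \<eta>"
  obtains h and c :: "nat \<Rightarrow> 'z::metric_space" and m L where "lipschitz_partition h c m L \<eta>"
proof -
  obtain K :: "'z set" where K: "finite K" "UNIV \<subseteq> (\<Union>x\<in>K. {y. dist x y < \<eta> / 2})"
    using assms unfolding totally_bounded_metric by (meson half_gt_zero)
  obtain xs where xs: "set xs = K" using finite_list[OF K(1)] by blast
  define c where "c k = xs ! k" for k
  define m where "m = length xs"
  define \<psi> where "\<psi> k x = max 0 (min 1 (2 - 2 / \<eta> * dist x (c k)))" for k x
  define L where "L = 2 / \<eta>"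
  have L: "0 < L" using assms(2) by (simp add: L_def)
  have \<psi>_Lip: "\<bar>\<psi> k x - \<psi> k y\<bar> \<le> L * dist x y" for k x y
  proof -
    have "\<bar>dist x (c k) - dist y (c k)\<bar> \<le> dist x y"
      using dist_triangle[of x "c k" y] dist_triangle[of y "c k" x] dist_commute[of x y] by linarith
    then have "L * \<bar>dist x (c k) - dist y (c k)\<bar> \<le> L * dist x y"
      using L by (intro mult_left_mono) auto
    moreover have "\<bar>\<psi> k x - \<psi> k y\<bar> \<le> \<bar>L * dist x (c k) - L * dist y (c k)\<bar>"
      unfolding \<psi>_def L_def by linarith
    moreover have "\<bar>L * dist x (c k) - L * dist y (c k)\<bar> = L * \<bar>dist x (c k) - dist y (c k)\<bar>"
      using L by (simp add: abs_mult right_diff_distrib[symmetric])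
    ultimately show ?thesis by linarith
  qed
  have \<psi>_01: "0 \<le> \<psi> k x" "\<psi> k x \<le> 1" for k x by (auto simp: \<psi>_def)
  have \<psi>_supp: "dist x (c k) < \<eta>" if "\<psi> k x > 0" for k x
  proof -
    have "2 / \<eta> * dist x (c k) < 2" using that by (auto simp: \<psi>_def)
    then show ?thesis using assms(2) by (simp add: field_simps)
  qed
  let ?M = "running_max \<psi>"
  have M_01: "0 \<le> ?M k x" "?M k x \<le> 1" for k x
    using \<psi>_01 by (induction k) (auto simp: le_max_iff_disj)
  have M_Lip: "\<bar>?M k x - ?M k y\<bar> \<le> L * dist x y" for k x y
  proof (induction k)
    case 0 then show ?case using L by simp
  next
    case (Suc k) then show ?case using \<psi>_Lip[of k x y] by auto
  qed
  have M_ge: "\<psi> j x \<le> ?M k x" if "j < k" for j k x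
    using that by (induction k) (auto simp: less_Suc_eq le_max_iff_disj)
  have M_1: "?M m x = 1" for x
  proof -
    obtain y where y: "y \<in> K" "dist y x < \<eta> / 2" using K(2) by auto
    then obtain k where k: "k < m" "y = c k"
      unfolding xs[symmetric] in_set_conv_nth m_def c_def by auto
    have "2 / \<eta> * dist x (c k) \<le> 1"
      using y(2) k(2) assms(2) by (simp add: dist_commute field_simps)
    then have "\<psi> k x = 1" by (simp add: \<psi>_def)
    with M_ge[OF k(1), of x] M_01(2)[of m x] show ?thesis by simp
  qed
  have "lipschitz_partition (\<lambda>k x. ?M (Suc k) x - ?M k x) c m (2 * L) \<eta>"
  proof
    fix k x y
    show "0 \<le> ?M (Suc k) x - ?M k x" by simp
    show "?M (Suc k) x - ?M k x \<le> 1" using M_01[of "Suc k" x] M_01[of k x] by linarith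
    show "\<bar>(?M (Suc k) x - ?M k x) - (?M (Suc k) y - ?M k y)\<bar> \<le> 2 * L * dist x y"
      using M_Lip[of "Suc k" x y] M_Lip[of k x y] by linarith
    show "(\<Sum>k<m. ?M (Suc k) x - ?M k x) = 1"
      using sum_lessThan_telescope[of "\<lambda>k. ?M k x" m]
      by (simp only: M_1 running_max.simps(1) diff_zero)
    assume "?M (Suc k) x - ?M k x \<noteq> 0"
    then have "?M k x < \<psi> k x" by auto
    with M_01(1)[of k x] show "dist x (c k) < \<eta>" by (intro \<psi>_supp) simp
  qed (use L in auto)
  then show thesis by (rule that)
qed

lemma one_in_sample_dist_set:
  assumes "1 \<le> n"
  shows "1 \<in> {\<epsilon>. \<epsilon> > 0 \<and> real (card {i \<in> {..<n}. dist (z i) (z' i) \<ge> \<epsilon>}) / real n \<le> \<epsilon>}"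
proof -
  have "card {i \<in> {..<n}. dist (z i) (z' i) \<ge> 1} \<le> card {..<n}"
    by (intro card_mono) auto
  then show ?thesis using assms by (simp add: divide_le_eq)
qed

lemma sample_dist_nonneg:
  assumes "1 \<le> n"
  shows "0 \<le> sample_dist n z z'"
  unfolding sample_dist_def
proof (rule cInf_greatest)
  show "{\<epsilon>. \<epsilon> > 0 \<and> real (card {i \<in> {..<n}. dist (z i) (z' i) \<ge> \<epsilon>}) / real n \<le> \<epsilon>} \<noteq> {}"
    using one_in_sample_dist_set[OF assms, of z z'] by blast
qed auto

context lipschitz_partition
begin

lemma h_measurable [measurable]: "h k \<in> borel_measurable borel"
proof -
  have "L-lipschitz_on UNIV (h k)"
    using Lipschitz L_nonneg by (intro lipschitz_onI) (auto simp: dist_real_def)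
  then show ?thesis
    by (intro borel_measurable_continuous_onI lipschitz_on_continuous_on)
qed

lemma integrable_h:
  assumes "\<mu> \<in> borel_prob_measures"
  shows "integrable \<mu> (h k)"
proof -
  from assms interpret prob_space \<mu> by (simp add: space_prob_algebra)
  have [measurable_cong]: "sets \<mu> = sets borel"
    using assms by (simp add: space_prob_algebra)
  show ?thesis
    by (rule integrable_const_bound[of _ 1]) (simp_all add: nonneg le_1 abs_of_nonneg)
qed

lemma integral_h_bounds:
  assumes "\<mu> \<in> borel_prob_measures"
  shows "0 \<le> (\<integral>x. h k x \<partial>\<mu>)" "(\<integral>x. h k x \<partial>\<mu>) \<le> 1"
proof -
  from assms interpret prob_space \<mu> by (simp add: space_prob_algebra)
  show "0 \<le> (\<integral>x. h k x \<partial>\<mu>)"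
    by (rule Bochner_Integration.integral_nonneg) (simp add: nonneg)
  have "(\<integral>x. h k x \<partial>\<mu>) \<le> (\<integral>x. 1 \<partial>\<mu>)"
    by (intro integral_mono integrable_h assms) (auto simp: le_1)
  then show "(\<integral>x. h k x \<partial>\<mu>) \<le> 1" by (simp add: prob_space)
qed

text \<open>
  A test function \<open>f\<close> of norm at most 1 is within \<open>\<eta>\<close> of its interpolation
  \<open>\<Sum>k<m. f (c k) * h k\<close>, and the coefficients of the latter are at most 1 in modulus.
\<close>

lemma bl_dist_le_partition:
  assumes \<mu>: "\<mu> \<in> borel_prob_measures" and \<nu>: "\<nu> \<in> borel_prob_measures"
  shows "bl_dist UNIV dist \<mu> \<nu> \<le> 2 * \<eta> + (\<Sum>k<m. \<bar>(\<integral>x. h k x \<partial>\<mu>) - (\<integral>x. h k x \<partial>\<nu>)\<bar>)"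
proof (rule bl_dist_le)
  fix f :: "'z \<Rightarrow> real" assume "bl_norm UNIV dist f \<le> 1"
  note f = bl_norm_dist_le_1_D[OF this]
  let ?s = "\<lambda>x. \<Sum>k<m. f (c k) * h k x"
  have near: "\<bar>f x - ?s x\<bar> \<le> \<eta>" for x
  proof -
    have "f x - ?s x = (\<Sum>k<m. h k x * (f x - f (c k)))"
    proof -
      have "f x = (\<Sum>k<m. f x * h k x)"
        using sum_1[of x] by (simp add: sum_distrib_left[symmetric])
      then show ?thesis
        by (simp only: right_diff_distrib sum_subtractf mult.commute)
    qed
    also have "\<bar>\<dots>\<bar> \<le> (\<Sum>k<m. \<bar>h k x * (f x - f (c k))\<bar>)" by (rule sum_abs)
    also have "\<dots> \<le> (\<Sum>k<m. h k x * \<eta>)"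
    proof (rule sum_mono)
      fix k
      have "\<bar>f x - f (c k)\<bar> \<le> \<eta>" if "h k x \<noteq> 0"
        using f(2)[of x "c k"] support[OF that] by linarith
      then show "\<bar>h k x * (f x - f (c k))\<bar> \<le> h k x * \<eta>"
        by (cases "h k x = 0") (auto simp: abs_mult nonneg abs_of_nonneg intro: mult_left_mono)
    qed
    also have "\<dots> = \<eta>" using sum_1[of x] by (simp add: sum_distrib_right[symmetric])
    finally show ?thesis .
  qed
  have step: "\<bar>(\<integral>x. f x \<partial>\<rho>) - (\<Sum>k<m. f (c k) * (\<integral>x. h k x \<partial>\<rho>))\<bar> \<le> \<eta>"
    if \<rho>: "\<rho> \<in> borel_prob_measures" for \<rho>
  proof -
    from \<rho> interpret prob_space \<rho> by (simp add: space_prob_algebra)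
    have [measurable_cong]: "sets \<rho> = sets borel" using \<rho> by (simp add: space_prob_algebra)
    note [measurable] = f(1)
    have int: "integrable \<rho> f"
      by (rule integrable_const_bound[of _ 1]) (auto simp: f(3))
    have ints: "integrable \<rho> ?s"
      by (intro Bochner_Integration.integrable_sum integrable_mult_right integrable_h \<rho>)
    have "(\<Sum>k<m. f (c k) * (\<integral>x. h k x \<partial>\<rho>)) = (\<integral>x. ?s x \<partial>\<rho>)"
      using integrable_h[OF \<rho>] by (subst Bochner_Integration.integral_sum) auto
    then have "\<bar>(\<integral>x. f x \<partial>\<rho>) - (\<Sum>k<m. f (c k) * (\<integral>x. h k x \<partial>\<rho>))\<bar> = \<bar>\<integral>x. f x - ?s x \<partial>\<rho>\<bar>"
      using int ints by simp
    also have "\<dots> \<le> (\<integral>x. \<bar>f x - ?s x\<bar> \<partial>\<rho>)" by simp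
    also have "\<dots> \<le> (\<integral>x. \<eta> \<partial>\<rho>)"
      using int ints by (intro integral_mono near integrable_abs) auto
    finally show ?thesis by (simp add: prob_space)
  qed
  have "\<bar>(\<Sum>k<m. f (c k) * (\<integral>x. h k x \<partial>\<mu>)) - (\<Sum>k<m. f (c k) * (\<integral>x. h k x \<partial>\<nu>))\<bar>
      \<le> (\<Sum>k<m. \<bar>f (c k) * ((\<integral>x. h k x \<partial>\<mu>) - (\<integral>x. h k x \<partial>\<nu>))\<bar>)"
    unfolding sum_subtractf[symmetric] right_diff_distrib by (rule sum_abs)
  also have "\<dots> \<le> (\<Sum>k<m. \<bar>(\<integral>x. h k x \<partial>\<mu>) - (\<integral>x. h k x \<partial>\<nu>)\<bar>)"
    using f(3) by (intro sum_mono) (auto simp: abs_mult intro: mult_left_le_one_le)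
  finally show "\<bar>(\<integral>x. f x \<partial>\<mu>) - (\<integral>x. f x \<partial>\<nu>)\<bar>
      \<le> 2 * \<eta> + (\<Sum>k<m. \<bar>(\<integral>x. h k x \<partial>\<mu>) - (\<integral>x. h k x \<partial>\<nu>)\<bar>)"
    using step[OF \<mu>] step[OF \<nu>] by linarith
qed

text \<open>
  The mean over the sample is used instead of the integral with respect to the empirical measure:
  it depends measurably on \<open>z\<close> by its form, and the two agree for \<open>n \<ge> 1\<close>.
\<close>

definition discrepancy :: "'z measure \<Rightarrow> nat \<Rightarrow> (nat \<Rightarrow> 'z) \<Rightarrow> real" where
  "discrepancy P n z = (\<Sum>k<m. \<bar>(\<Sum>i<n. h k (z i)) / n - (\<integral>x. h k x \<partial>P)\<bar>)"

lemma discrepancy_nonneg: "0 \<le> discrepancy P n z"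
  unfolding discrepancy_def by (intro sum_nonneg) auto

lemma mean_diff_le_1:
  assumes "\<mu> \<in> borel_prob_measures"
  shows "\<bar>(\<Sum>i<n. h k (z i)) / real n - (\<integral>x. h k x \<partial>\<mu>)\<bar> \<le> 1"
proof -
  have "0 \<le> (\<Sum>i<n. h k (z i)) / n" by (intro divide_nonneg_nonneg sum_nonneg nonneg) auto
  moreover have "(\<Sum>i<n. h k (z i)) / n \<le> 1"
    using sum_bounded_above[of "{..<n}" "\<lambda>i. h k (z i)" 1] le_1
    by (cases "n = 0") (auto simp: divide_le_eq)
  ultimately show ?thesis using integral_h_bounds[OF assms, of k] by linarith
qed

lemma discrepancy_le:
  assumes "P \<in> borel_prob_measures"
  shows "discrepancy P n z \<le> m"
proof -
  have "discrepancy P n z \<le> (\<Sum>k<m. 1)"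
    unfolding discrepancy_def by (intro sum_mono mean_diff_le_1 assms)
  then show ?thesis by simp
qed

lemma discrepancy_measurable [measurable]:
  "discrepancy P n \<in> borel_measurable (sample_algebra n)"
  unfolding discrepancy_def[abs_def] by measurable

lemma integrable_discrepancy:
  assumes "P \<in> borel_prob_measures" "prob_space M" "sets M = sets (sample_algebra n)"
  shows "integrable M (discrepancy P n)"
proof -
  interpret prob_space M by fact
  show ?thesis
    using discrepancy_nonneg discrepancy_le[OF assms(1)]
    by (intro integrable_const_bound[of _ "real m"])
       (auto simp: measurable_cong_sets[OF assms(3) refl])
qed

lemma bl_dist_empirical_le:
  assumes "1 \<le> n" "P \<in> borel_prob_measures"
  shows "bl_dist UNIV dist (empirical n z) P \<le> 2 * \<eta> + discrepancy P n z"
  using bl_dist_le_partition[OF empirical_in_prob_measures[OF assms(1)] assms(2)]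
  by (simp add: discrepancy_def integral_empirical[OF assms(1)])

text \<open>
  Resampling once costs only \<open>m / sqrt n\<close> in mean, uniformly in the sample \<open>z\<close>, by the law of large
  numbers for the empirical measure of \<open>z\<close>.
\<close>

lemma integral_discrepancy_resample_le:
  assumes n: "1 \<le> n" and P: "P \<in> borel_prob_measures"
  shows "(\<integral>w. discrepancy P n w \<partial>resample n z) \<le> discrepancy P n z + m / sqrt n"
proof -
  let ?R = "resample n z" and ?E = "empirical n z"
  let ?d = "\<lambda>w k. \<bar>(\<Sum>i<n. h k (w i)) / n - (\<integral>x. h k x \<partial>?E)\<bar>"
  interpret R: prob_space ?R by (rule prob_space_resample[OF n])
  note setsR = sets_resample[OF n, of z]
  have E: "?E \<in> borel_prob_measures" by (rule empirical_in_prob_measures[OF n])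
  then have prob_E: "prob_space ?E" and setsE: "sets ?E = sets borel"
    by (simp_all add: space_prob_algebra)
  have meas: "(\<lambda>w. ?d w k) \<in> borel_measurable ?R" for k
    unfolding measurable_cong_sets[OF setsR refl] by measurable
  have intd: "integrable ?R (\<lambda>w. ?d w k)" for k
  proof (rule R.integrable_const_bound[of _ 1])
    show "AE w in ?R. norm (?d w k) \<le> 1" using mean_diff_le_1[OF E] by simp
  qed (rule meas)
  have "(\<integral>w. discrepancy P n w \<partial>?R) \<le> (\<integral>w. discrepancy P n z + (\<Sum>k<m. ?d w k) \<partial>?R)"
  proof (rule integral_mono)
    show "discrepancy P n w \<le> discrepancy P n z + (\<Sum>k<m. ?d w k)" for w
      unfolding discrepancy_def sum.distrib[symmetric] integral_empirical[OF n h_measurable]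
      by (rule sum_mono) linarith
  qed (use intd integrable_discrepancy[OF P R.prob_space_axioms setsR] in auto)
  also have "\<dots> = discrepancy P n z + (\<Sum>k<m. \<integral>w. ?d w k \<partial>?R)"
    using intd by (simp add: R.prob_space Bochner_Integration.integral_sum)
  also have "(\<Sum>k<m. \<integral>w. ?d w k \<partial>?R) \<le> (\<Sum>k<m. 1 / sqrt n)"
    unfolding resample_def
    using n by (intro sum_mono mean_deviation_le prob_E nonneg le_1)
       (simp_all add: measurable_cong_sets[OF setsE refl])
  finally show ?thesis by simp
qed

text \<open>
  If at most \<open>n * \<epsilon>\<close> coordinates differ by \<open>\<epsilon>\<close> or more, these change a mean of the \<open>h k\<close> by at
  most \<open>\<epsilon>\<close>, and the others change it by at most \<open>L * \<epsilon>\<close>.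
\<close>

lemma discrepancy_Lipschitz:
  assumes n: "1 \<le> n"
  shows "\<bar>discrepancy P n z - discrepancy P n z'\<bar> \<le> m * (L + 1) * sample_dist n z z'"
proof -
  let ?E = "{\<epsilon>. \<epsilon> > 0 \<and> real (card {i \<in> {..<n}. dist (z i) (z' i) \<ge> \<epsilon>}) / real n \<le> \<epsilon>}"
  let ?D = "\<bar>discrepancy P n z - discrepancy P n z'\<bar>"
  have n0: "0 < real n" using n by simp
  have bound: "?D \<le> m * (L + 1) * \<epsilon>" if \<epsilon>: "\<epsilon> \<in> ?E" for \<epsilon>
  proof -
    let ?B = "{i \<in> {..<n}. dist (z i) (z' i) \<ge> \<epsilon>}"
    have mean: "\<bar>(\<Sum>i<n. h k (z i)) / n - (\<Sum>i<n. h k (z' i)) / n\<bar> \<le> (L + 1) * \<epsilon>" for k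
    proof -
      have "\<bar>(\<Sum>i<n. h k (z i)) - (\<Sum>i<n. h k (z' i))\<bar> \<le> (\<Sum>i<n. \<bar>h k (z i) - h k (z' i)\<bar>)"
        unfolding sum_subtractf[symmetric] by (rule sum_abs)
      also have "\<dots> \<le> (\<Sum>i<n. L * \<epsilon> + of_bool (i \<in> ?B))"
      proof (rule sum_mono)
        fix i assume i: "i \<in> {..<n}"
        show "\<bar>h k (z i) - h k (z' i)\<bar> \<le> L * \<epsilon> + of_bool (i \<in> ?B)"
        proof (cases "i \<in> ?B")
          case True
          have "0 \<le> L * \<epsilon>" using \<epsilon> L_nonneg by simp
          then show ?thesis
            using True nonneg[of k "z i"] nonneg[of k "z' i"] le_1[of k "z i"] le_1[of k "z' i"]
            by simp
        next
          case False
          then have "dist (z i) (z' i) \<le> \<epsilon>" using i by auto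
          then have "L * dist (z i) (z' i) \<le> L * \<epsilon>" using L_nonneg by (rule mult_left_mono)
          with Lipschitz[of k "z i" "z' i"] False show ?thesis by simp
        qed
      qed
      also have "\<dots> = n * (L * \<epsilon>) + card ?B"
        by (simp add: sum.distrib of_bool_def sum.If_cases Int_def)
      also have "\<dots> \<le> n * (L * \<epsilon>) + n * \<epsilon>"
        using \<epsilon> n0 by (simp add: divide_le_eq mult.commute)
      finally have "\<bar>(\<Sum>i<n. h k (z i)) - (\<Sum>i<n. h k (z' i))\<bar> \<le> n * ((L + 1) * \<epsilon>)"
        by (simp add: algebra_simps)
      then show ?thesis
        using n0 by (simp add: diff_divide_distrib[symmetric] divide_le_eq mult.commute)
    qed
    have "?D \<le> (\<Sum>k<m. (L + 1) * \<epsilon>)"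
      unfolding discrepancy_def sum_subtractf[symmetric]
    proof (rule order_trans[OF sum_abs sum_mono])
      fix k
      show "\<bar>\<bar>(\<Sum>i<n. h k (z i)) / n - (\<integral>x. h k x \<partial>P)\<bar> - \<bar>(\<Sum>i<n. h k (z' i)) / n - (\<integral>x. h k x \<partial>P)\<bar>\<bar>
          \<le> (L + 1) * \<epsilon>"
        using mean[of k] by linarith
    qed
    then show ?thesis by simp
  qed
  show ?thesis
  proof (cases "m = 0")
    case True
    then show ?thesis unfolding discrepancy_def by simp
  next
    case False
    then have pos: "0 < m * (L + 1)" using L_nonneg by simp
    have "?D / (m * (L + 1)) \<le> sample_dist n z z'"
      unfolding sample_dist_def
    proof (rule cInf_greatest)
      show "?E \<noteq> {}" using one_in_sample_dist_set[OF n, of z z'] by blast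
      show "?D / (m * (L + 1)) \<le> \<epsilon>" if "\<epsilon> \<in> ?E" for \<epsilon>
        using bound[OF that] pos by (simp add: divide_le_eq mult.commute)
    qed
    then show ?thesis using pos by (simp add: divide_le_eq mult.commute)
  qed
qed

text \<open>
  Scaled to norm at most 1, the discrepancy is itself a test function for the distance between laws
  of the data. The constant does not depend on \<open>n\<close>.
\<close>

lemma integral_discrepancy_le_bl_dist:
  assumes n: "1 \<le> n" and P: "P \<in> borel_prob_measures"
    and M: "prob_space M" "sets M = sets (sample_algebra n)"
    and N: "prob_space N" "sets N = sets (sample_algebra n)"
  shows "(\<integral>z. discrepancy P n z \<partial>N) \<le> (\<integral>z. discrepancy P n z \<partial>M)
    + (m * (L + 2) + 1) * bl_dist ({..<n} \<rightarrow>\<^sub>E UNIV) (sample_dist n) M N"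
proof -
  let ?X = "{..<n} \<rightarrow>\<^sub>E (UNIV :: 'z set)"
  \<comment> \<open>Lipschitz constant \<open>m * (L + 1)\<close> plus supremum \<open>m\<close>; the summand 1 makes the divisor positive.\<close>
  define K where "K = m * (L + 2) + 1"
  have K: "0 < K" using L_nonneg by (simp add: K_def add_nonneg_pos)
  have space: "space M = ?X" "space N = ?X"
    using sets_eq_imp_space_eq[OF M(2)] sets_eq_imp_space_eq[OF N(2)] by (simp_all add: space_PiM)
  have "bl_norm ?X (sample_dist n) (\<lambda>z. discrepancy P n z / K) \<le> 1"
  proof (rule bl_norm_le_1_I[of _ _ "m * (L + 1) / K" _ "m / K"])
    show "\<bar>discrepancy P n z / K - discrepancy P n z' / K\<bar> \<le> m * (L + 1) / K * sample_dist n z z'"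
      for z z'
      using divide_right_mono[OF discrepancy_Lipschitz[OF n, of P z z'], of K] K
      by (simp add: diff_divide_distrib[symmetric])
    show "\<bar>discrepancy P n z / K\<bar> \<le> m / K" for z
      using discrepancy_nonneg[of P n z] discrepancy_le[OF P, of n z] K
      by (simp add: divide_right_mono)
    show "m * (L + 1) / K + m / K \<le> 1"
      using K by (simp add: add_divide_distrib[symmetric] K_def algebra_simps)
    show "0 \<le> sample_dist n z z'" for z z' :: "nat \<Rightarrow> 'z"
      by (rule sample_dist_nonneg[OF n])
    show "0 \<le> m * (L + 1) / K" "0 \<le> m / K"
      using K L_nonneg by simp_all
  qed
  from integral_diff_le_bl_dist[OF M(1) N(1) space this]
  have "\<bar>((\<integral>z. discrepancy P n z \<partial>M) - (\<integral>z. discrepancy P n z \<partial>N)) / K\<bar>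
      \<le> bl_dist ?X (sample_dist n) M N"
    by (simp only: integral_divide_zero diff_divide_distrib)
  then have "\<bar>(\<integral>z. discrepancy P n z \<partial>M) - (\<integral>z. discrepancy P n z \<partial>N)\<bar>
      \<le> K * bl_dist ?X (sample_dist n) M N"
    using K by (simp add: abs_divide pos_divide_le_eq mult.commute)
  then show ?thesis unfolding K_def by linarith
qed

text \<open>
  Almost surely every mean of an \<open>h k\<close> converges to its integral with respect to \<open>P\<close>, and the
  discrepancy never exceeds \<open>m\<close>, so dominated convergence applies.
\<close>

lemma integral_discrepancy_marginal_tendsto_0:
  assumes PN: "sets PN = sets (PiM UNIV (\<lambda>_. borel))"
    and vara: "strong_varadarajan PN (\<lambda>i \<omega>. \<omega> i) P"
  shows "(\<lambda>n. \<integral>z. discrepancy P n z \<partial>marginal n PN) \<longlonglongrightarrow> 0"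
proof -
  from vara have P: "P \<in> borel_prob_measures" and "prob_space PN"
    and AE: "AE \<omega> in PN. (\<lambda>n. prohorov_dist (empirical n (\<lambda>i. \<omega> i)) P) \<longlonglongrightarrow> 0"
    by (simp_all add: strong_varadarajan_def)
  interpret prob_space PN by fact
  have restr: "(\<lambda>\<omega>. restrict \<omega> {..<n}) \<in> measurable PN (sample_algebra n)" for n
    unfolding measurable_cong_sets[OF PN refl]
    by (intro measurable_restrict measurable_component_singleton) auto
  have disc: "discrepancy P n (restrict \<omega> {..<n}) = discrepancy P n \<omega>" for n \<omega>
    by (simp add: discrepancy_def)
  have meas: "discrepancy P n \<in> borel_measurable PN" for n
    using measurable_compose[OF restr discrepancy_measurable, of P n] by (simp add: disc)
  have "(\<integral>z. discrepancy P n z \<partial>marginal n PN) = (\<integral>\<omega>. discrepancy P n \<omega> \<partial>PN)" for n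
    unfolding marginal_def by (simp add: integral_distr[OF restr] disc)
  moreover have "(\<lambda>n. \<integral>\<omega>. discrepancy P n \<omega> \<partial>PN) \<longlonglongrightarrow> (\<integral>\<omega>. 0 \<partial>PN)"
  proof (rule integral_dominated_convergence[where w = "\<lambda>_. real m"])
    show "AE \<omega> in PN. (\<lambda>n. discrepancy P n \<omega>) \<longlonglongrightarrow> 0"
      using AE
    proof eventually_elim
      case (elim \<omega>)
      have "(\<lambda>n. \<integral>x. h k x \<partial>empirical n \<omega>) \<longlonglongrightarrow> (\<integral>x. h k x \<partial>P)" for k
        by (rule integral_tendsto_of_prohorov_dist[OF _ P nonneg le_1 Lipschitz L_nonneg])
           (use elim in \<open>auto intro: empirical_in_prob_measures\<close>)
      then have "(\<lambda>n. \<Sum>k<m. \<bar>(\<integral>x. h k x \<partial>empirical n \<omega>) - (\<integral>x. h k x \<partial>P)\<bar>)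
          \<longlonglongrightarrow> (\<Sum>k<m. \<bar>(\<integral>x. h k x \<partial>P) - (\<integral>x. h k x \<partial>P)\<bar>)"
        by (intro tendsto_intros)
      then have "(\<lambda>n. \<Sum>k<m. \<bar>(\<integral>x. h k x \<partial>empirical n \<omega>) - (\<integral>x. h k x \<partial>P)\<bar>) \<longlonglongrightarrow> 0"
        by simp
      moreover have "eventually (\<lambda>n. (\<Sum>k<m. \<bar>(\<integral>x. h k x \<partial>empirical n \<omega>) - (\<integral>x. h k x \<partial>P)\<bar>)
          = discrepancy P n \<omega>) sequentially"
        using eventually_ge_at_top[of 1]
        by eventually_elim (simp add: discrepancy_def integral_empirical)
      ultimately show ?case by (rule Lim_transform_eventually)
    qed
    show "AE \<omega> in PN. norm (discrepancy P n \<omega>) \<le> real m" for n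
      using discrepancy_nonneg discrepancy_le[OF P] by simp
  qed (use meas in auto)
  ultimately show ?thesis by simp
qed

end

section \<open>Bootstrap laws near a Dirac measure\<close>

lemma measurable_resample':
  assumes "1 \<le> n" "sets R = sets (sample_algebra n)"
  shows "resample n \<in> measurable R (subprob_algebra (sample_algebra n))"
  using measurable_resample[OF assms(1)] by (simp add: measurable_cong_sets[OF assms(2) refl])

lemma sets_bootstrap_sample_law:
  assumes "1 \<le> n" "sets R = sets (sample_algebra n)"
  shows "sets (bootstrap_sample_law n R) = sets (sample_algebra n)"
proof -
  have "space R \<noteq> {}"
    using sets_eq_imp_space_eq[OF assms(2)] by (simp add: space_PiM PiE_eq_empty_iff)
  then show ?thesis
    unfolding bootstrap_sample_law_def by (intro sets_bind sets_resample assms(1))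
qed

lemma prob_space_bootstrap_sample_law:
  assumes "1 \<le> n" "prob_space R" "sets R = sets (sample_algebra n)"
  shows "prob_space (bootstrap_sample_law n R)"
  unfolding bootstrap_sample_law_def
  by (rule prob_space.prob_space_bind[OF assms(2) _ measurable_resample'[OF assms(1,3)]])
     (simp add: prob_space_resample[OF assms(1)])

lemma (in lipschitz_partition) integral_discrepancy_bootstrap_sample_le:
  assumes n: "1 \<le> n" and P: "P \<in> borel_prob_measures"
    and R: "prob_space R" "sets R = sets (sample_algebra n)"
  shows "(\<integral>w. discrepancy P n w \<partial>bootstrap_sample_law n R)
    \<le> (\<integral>z. discrepancy P n z \<partial>R) + m / sqrt n"
proof -
  interpret R: prob_space R by fact
  have "(\<integral>w. discrepancy P n w \<partial>bootstrap_sample_law n R)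
      = (\<integral>z. \<integral>w. discrepancy P n w \<partial>resample n z \<partial>R)"
    unfolding bootstrap_sample_law_def
  proof (rule integral_bind[where K = "sample_algebra n" and B = "real m" and B' = 1])
    show "\<bar>discrepancy P n w\<bar> \<le> real m" for w
      using discrepancy_nonneg[of P n w] discrepancy_le[OF P, of n w] by simp
    show "AE z in R. emeasure (resample n z) (space (resample n z)) \<le> ennreal 1"
      by (simp add: prob_space.emeasure_space_1[OF prob_space_resample[OF n]])
    show "finite_measure R" by unfold_locales
  qed (simp_all add: measurable_resample'[OF n R(2)])
  also have "\<dots> \<le> (\<integral>z. discrepancy P n z + m / sqrt n \<partial>R)"
    using integrable_discrepancy[OF P R] discrepancy_nonneg
    by (intro integral_mono' integral_discrepancy_resample_le[OF n P]) auto
  also have "\<dots> = (\<integral>z. discrepancy P n z \<partial>R) + m / sqrt n"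
    using integrable_discrepancy[OF P R] by (simp add: R.prob_space)
  finally show ?thesis .
qed

text \<open>
  If the estimator \<open>T\<close> is close to \<open>s\<close> on samples of small discrepancy from \<open>P\<close>, then after two
  rounds of resampling from the law \<open>R\<close> of the data the bootstrap law is close to the Dirac measure
  at the Dirac measure at \<open>s\<close>. Each round contributes one term \<open>m / sqrt n\<close>. Since the hypothesis
  is linear in the discrepancy, only its mean enters.
\<close>

lemma bootstrap_law_near_return:
  fixes T :: "(nat \<Rightarrow> 'z::{metric_space, second_countable_topology}) \<Rightarrow> 'h::metric_space"
  assumes partition: "lipschitz_partition h c m L \<eta>"
    and n: "1 \<le> n" and P: "P \<in> borel_prob_measures"
    and R: "prob_space R" "sets R = sets (sample_algebra n)"
    and T: "continuous_map (product_topology (\<lambda>_. euclidean) {..<n}) euclidean T"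
    and ab: "0 \<le> a" "0 \<le> b"
    and near: "\<And>w. w \<in> {..<n} \<rightarrow>\<^sub>E UNIV \<Longrightarrow>
      min 2 (dist (T w) s) \<le> a + b * lipschitz_partition.discrepancy h m P n w"
    and f: "bl_norm borel_prob_measures (bl_dist UNIV dist) f \<le> 1"
      "f \<in> borel_measurable weak_borel"
  shows "\<bar>(\<integral>\<mu>. f \<mu> \<partial>bootstrap_law n T R) - f (return borel s)\<bar>
    \<le> a + b * ((\<integral>z. lipschitz_partition.discrepancy h m P n z \<partial>R) + 2 * real m / sqrt n)"
proof -
  interpret lipschitz_partition h c m L \<eta> by fact
  let ?B = "bootstrap_sample_law n R" and ?G = "\<lambda>w. distr (resample n w) borel T"
  note setsB = sets_bootstrap_sample_law[OF n R(2)]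
  interpret B: prob_space ?B by (rule prob_space_bootstrap_sample_law[OF n R])
  note Tm = continuous_map_imp_measurable_sample[OF T]
  note G = distr_resample_in_prob_measures[OF n Tm]
  have Dirac: "return borel s \<in> borel_prob_measures"
    by (simp add: space_prob_algebra prob_space_return)
  have Gm: "?G \<in> measurable ?B weak_borel"
    unfolding measurable_cong_sets[OF setsB refl] by (rule measurable_distr_resample[OF n T])
  have fG: "\<bar>f (?G w) - f (return borel s)\<bar> \<le> a + b * (discrepancy P n w + m / sqrt n)"
    (is "_ \<le> ?r w") for w
  proof (cases "?G w = return borel s")
    case True
    then show ?thesis using ab discrepancy_nonneg[of P n w] by simp
  next
    case False
    note setsR = sets_resample[OF n, of w]
    interpret Rw: prob_space "resample n w" by (rule prob_space_resample[OF n])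
    have int: "integrable (resample n w) (discrepancy P n)"
      by (rule integrable_discrepancy[OF P Rw.prob_space_axioms setsR])
    have "\<bar>f (?G w) - f (return borel s)\<bar> \<le> bl_dist UNIV dist (?G w) (return borel s)"
      by (rule bl_norm_le_1_D(2)[OF f(1) G Dirac False bl_dist_return_pos[OF G False]])
    also have "\<dots> \<le> (\<integral>x. min 2 (dist x s) \<partial>?G w)"
      by (rule bl_dist_return_le[OF G])
    also have "\<dots> = (\<integral>v. min 2 (dist (T v) s) \<partial>resample n w)"
    proof (rule integral_distr)
      show "T \<in> borel_measurable (resample n w)"
        using Tm by (simp add: measurable_cong_sets[OF setsR refl])
      show "(\<lambda>x. min 2 (dist x s)) \<in> borel_measurable borel"
        by (intro borel_measurable_continuous_onI continuous_intros)
    qed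
    also have "\<dots> \<le> (\<integral>v. a + b * discrepancy P n v \<partial>resample n w)"
    proof (rule integral_mono')
      show "min 2 (dist (T v) s) \<le> a + b * discrepancy P n v"
        if "v \<in> space (resample n w)" for v
        using that near[of v] sets_eq_imp_space_eq[OF setsR] by (simp add: space_PiM)
    qed (use int ab discrepancy_nonneg in auto)
    also have "\<dots> = a + b * (\<integral>v. discrepancy P n v \<partial>resample n w)"
      using int by (simp add: Rw.prob_space)
    also have "\<dots> \<le> ?r w"
      using integral_discrepancy_resample_le[OF n P, of w] ab
      by (intro add_left_mono mult_left_mono)
    finally show ?thesis .
  qed
  have intD: "integrable ?B (discrepancy P n)"
    by (rule integrable_discrepancy[OF P B.prob_space_axioms setsB])
  have fGm: "(\<lambda>w. f (?G w)) \<in> borel_measurable ?B"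
    by (rule measurable_compose[OF Gm f(2)])
  have intf: "integrable ?B (\<lambda>w. f (?G w))"
    using fGm bl_norm_le_1_D(1)[OF f(1) G] by (intro B.integrable_const_bound[of _ 1]) auto
  have "(\<integral>\<mu>. f \<mu> \<partial>bootstrap_law n T R) = (\<integral>w. f (?G w) \<partial>?B)"
    unfolding bootstrap_law_def by (rule integral_distr[OF Gm f(2)])
  then have "\<bar>(\<integral>\<mu>. f \<mu> \<partial>bootstrap_law n T R) - f (return borel s)\<bar>
      = \<bar>\<integral>w. f (?G w) - f (return borel s) \<partial>?B\<bar>"
    using intf by (simp add: B.prob_space)
  also have "\<dots> \<le> (\<integral>w. \<bar>f (?G w) - f (return borel s)\<bar> \<partial>?B)" by simp
  also have "\<dots> \<le> (\<integral>w. a + b * (discrepancy P n w + m / sqrt n) \<partial>?B)"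
    using intf intD by (intro integral_mono fG) auto
  also have "\<dots> = a + b * ((\<integral>w. discrepancy P n w \<partial>?B) + m / sqrt n)"
    using intD by (simp add: B.prob_space)
  also have "\<dots> \<le> a + b * ((\<integral>z. discrepancy P n z \<partial>R) + 2 * real m / sqrt n)"
    using integral_discrepancy_bootstrap_sample_le[OF n P R] ab
    by (intro add_left_mono mult_left_mono) (auto simp: add_divide_distrib[symmetric])
  finally show ?thesis .
qed

section \<open>Qualitative robustness of the bootstrap\<close>

lemma marginal_prob_space:
  assumes "prob_space PN" "sets PN = sets (PiM UNIV (\<lambda>_. borel :: 'z::topological_space measure))"
  shows "prob_space (marginal n PN)" "sets (marginal n PN) = sets (sample_algebra n)"
proof -
  have "(\<lambda>\<omega>. restrict \<omega> {..<n}) \<in> measurable PN (sample_algebra n)"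
    unfolding measurable_cong_sets[OF assms(2) refl]
    by (intro measurable_restrict measurable_component_singleton) auto
  then show "prob_space (marginal n PN)"
    unfolding marginal_def by (rule prob_space.prob_space_distr[OF assms(1)])
qed (simp add: marginal_def)

theorem theorem2p2:
  fixes S :: "'z::{metric_space, second_countable_topology} measure
                \<Rightarrow> 'h::{metric_space, second_countable_topology}"
    and Sn :: "nat \<Rightarrow> (nat \<Rightarrow> 'z) \<Rightarrow> 'h"
    and PN :: "(nat \<Rightarrow> 'z) measure"
    and Pc :: "nat \<Rightarrow> 'z measure"
    and P :: "'z measure"
  assumes Z_polish: "completely_metrizable_space (euclidean :: 'z topology)"
    and Z_totally_bounded: "totally_bounded (UNIV :: 'z set)"
    and H_polish: "completely_metrizable_space (euclidean :: 'h topology)"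
    and represented:
      "\<And>n z. n \<ge> 1 \<Longrightarrow> z \<in> {..<n} \<rightarrow>\<^sub>E UNIV \<Longrightarrow> Sn n z = S (empirical n z)"
    and Pc_prob: "\<And>i. Pc i \<in> borel_prob_measures"
    and PN_product: "PN = PiM UNIV Pc"
    and P_prob: "P \<in> borel_prob_measures"
    and varadarajan: "strong_varadarajan PN (\<lambda>i \<omega>. \<omega> i) P"
    and S_continuous_at:
      "\<forall>\<epsilon>>0. \<exists>\<delta>>0. \<forall>\<mu>\<in>borel_prob_measures.
         bl_dist UNIV dist \<mu> P < \<delta> \<longrightarrow> dist (S \<mu>) (S P) < \<epsilon>"
    and Sn_continuous:
      "\<And>n. n \<ge> 1 \<Longrightarrow>
         continuous_map (product_topology (\<lambda>_. euclidean) {..<n}) euclidean (Sn n)"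
  shows
    "\<forall>\<epsilon>>0. \<exists>\<delta>>0. \<exists>n0\<ge>1. \<forall>n\<ge>n0. \<forall>QN\<in>product_laws.
       bl_dist ({..<n} \<rightarrow>\<^sub>E UNIV) (sample_dist n) (marginal n PN) (marginal n QN) < \<delta> \<longrightarrow>
       bl_dist borel_prob_measures (bl_dist UNIV dist)
         (bootstrap_law n (Sn n) (marginal n PN))
         (bootstrap_law n (Sn n) (marginal n QN)) < \<epsilon>"
proof (intro allI impI)
  fix \<epsilon> :: real assume \<epsilon>: "0 < \<epsilon>"
  have setsPN: "sets PN = sets (PiM UNIV (\<lambda>_. borel))"
    using Pc_prob unfolding PN_product by (intro sets_PiM_cong) (auto simp: space_prob_algebra)
  have probPN: "prob_space PN"
    using varadarajan by (simp add: strong_varadarajan_def)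
  obtain d where d: "0 < d" and S: "\<And>\<mu>. \<mu> \<in> borel_prob_measures \<Longrightarrow>
      bl_dist UNIV dist \<mu> P < d \<Longrightarrow> dist (S \<mu>) (S P) < \<epsilon> / 12"
    using S_continuous_at[rule_format, of "\<epsilon> / 12"] \<epsilon> by auto
  \<comment> \<open>The budget: \<open>\<epsilon> / 3\<close> for each of the two laws, half of it for the constant in \<open>near\<close> and half
    for the mean discrepancy. The radius \<open>\<eta>\<close> satisfies \<open>2 / d * (2 * \<eta>) = \<epsilon> / 12\<close>.\<close>
  define \<eta> where "\<eta> = \<epsilon> * d / 48"
  have \<eta>: "0 < \<eta>" using \<epsilon> d by (simp add: \<eta>_def)
  obtain h and c :: "nat \<Rightarrow> 'z" and m L where part: "lipschitz_partition h c m L \<eta>"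
    using lipschitz_partition_exists[OF Z_totally_bounded \<eta>] by blast
  interpret lipschitz_partition h c m L \<eta> by (rule part)
  have near: "min 2 (dist (Sn n w) (S P)) \<le> \<epsilon> / 6 + 2 / d * discrepancy P n w"
    if n: "1 \<le> n" and w: "w \<in> {..<n} \<rightarrow>\<^sub>E UNIV" for n w
  proof -
    have bl: "bl_dist UNIV dist (empirical n w) P \<le> 2 * \<eta> + discrepancy P n w"
      by (rule bl_dist_empirical_le[OF n P_prob])
    have D: "0 \<le> 2 / d * discrepancy P n w"
      using d discrepancy_nonneg[of P n w] by simp
    show ?thesis
    proof (cases "bl_dist UNIV dist (empirical n w) P < d")
      case True
      then have "dist (Sn n w) (S P) < \<epsilon> / 12"
        using S[OF empirical_in_prob_measures[OF n]] represented[OF n w] by simp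
      with D \<epsilon> show ?thesis by linarith
    next
      case False
      \<comment> \<open>The truncation at 2 is now absorbed by \<open>2 / d\<close> times the distance, which is at least \<open>d\<close>.\<close>
      with bl have "d \<le> 2 * \<eta> + discrepancy P n w" by linarith
      then have "2 / d * d \<le> 2 / d * (2 * \<eta> + discrepancy P n w)"
        using d by (intro mult_left_mono) auto
      then have "2 \<le> 2 / d * (2 * \<eta>) + 2 / d * discrepancy P n w"
        using d by (simp add: distrib_left)
      also have "2 / d * (2 * \<eta>) = \<epsilon> / 12" using d by (simp add: \<eta>_def)
      finally show ?thesis using \<epsilon> by linarith
    qed
  qed
  \<comment> \<open>A third of \<open>\<tau>\<close> each for the mean discrepancy under \<open>PN\<close>, for the two resampling errors, and
    for the passage from \<open>PN\<close> to \<open>QN\<close>.\<close>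
  define \<tau> where "\<tau> = \<epsilon> * d / 12"
  have \<tau>: "0 < \<tau>" "2 / d * \<tau> = \<epsilon> / 6" using \<epsilon> d by (simp_all add: \<tau>_def)
  define K where "K = m * (L + 2) + 1"
  have K: "0 < K" using L_nonneg by (simp add: K_def add_nonneg_pos)
  define \<delta> where "\<delta> = \<tau> / (3 * K)"
  have \<delta>: "0 < \<delta>" "K * \<delta> = \<tau> / 3" using \<tau> K by (simp_all add: \<delta>_def)
  have "eventually (\<lambda>n. (\<integral>z. discrepancy P n z \<partial>marginal n PN) < \<tau> / 3) sequentially"
    by (rule order_tendstoD(2)[OF integral_discrepancy_marginal_tendsto_0[OF setsPN varadarajan]])
       (use \<tau> in simp)
  moreover have "eventually (\<lambda>n. 2 * real m / sqrt n < \<tau> / 3) sequentially"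
  proof (rule order_tendstoD(2))
    show "(\<lambda>n. 2 * real m / sqrt (real n)) \<longlonglongrightarrow> 0"
      by (intro tendsto_divide_0[OF tendsto_const] filterlim_at_top_imp_at_infinity
          filterlim_compose[OF sqrt_at_top] filterlim_real_sequentially)
  qed (use \<tau> in simp)
  moreover have "eventually (\<lambda>n::nat. 1 \<le> n) sequentially" by (rule eventually_ge_at_top)
  ultimately have "eventually (\<lambda>n. (\<integral>z. discrepancy P n z \<partial>marginal n PN) < \<tau> / 3 \<and>
      2 * real m / sqrt n < \<tau> / 3 \<and> 1 \<le> n) sequentially"
    by eventually_elim auto
  then obtain n0 where n0: "\<And>n. n0 \<le> n \<Longrightarrow>
      (\<integral>z. discrepancy P n z \<partial>marginal n PN) < \<tau> / 3 \<and> 2 * real m / sqrt n < \<tau> / 3 \<and> 1 \<le> n"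
    by (auto simp: eventually_sequentially)
  show "\<exists>\<delta>>0. \<exists>n0\<ge>1. \<forall>n\<ge>n0. \<forall>QN\<in>product_laws.
       bl_dist ({..<n} \<rightarrow>\<^sub>E UNIV) (sample_dist n) (marginal n PN) (marginal n QN) < \<delta> \<longrightarrow>
       bl_dist borel_prob_measures (bl_dist UNIV dist)
         (bootstrap_law n (Sn n) (marginal n PN))
         (bootstrap_law n (Sn n) (marginal n QN)) < \<epsilon>"
  proof (intro exI[of _ \<delta>] exI[of _ n0] conjI allI ballI impI)
    show "0 < \<delta>" by (rule \<delta>)
    show "1 \<le> n0" using n0[of n0] by simp
    fix n and QN :: "(nat \<Rightarrow> 'z) measure"
    assume "n0 \<le> n" and QN: "QN \<in> product_laws"
      and close: "bl_dist ({..<n} \<rightarrow>\<^sub>E UNIV) (sample_dist n) (marginal n PN) (marginal n QN) < \<delta>"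
    from n0[OF \<open>n0 \<le> n\<close>] have n: "1 \<le> n" and small: "2 * real m / sqrt n < \<tau> / 3"
      and DP: "(\<integral>z. discrepancy P n z \<partial>marginal n PN) < \<tau> / 3" by auto
    from QN have "prob_space QN" "sets QN = sets (PiM UNIV (\<lambda>_. borel))"
      by (simp_all add: product_laws_def space_prob_algebra)
    note Qn = marginal_prob_space[OF this, of n]
    note Pn = marginal_prob_space[OF probPN setsPN, of n]
    have "(\<integral>z. discrepancy P n z \<partial>marginal n QN) \<le> (\<integral>z. discrepancy P n z \<partial>marginal n PN)
        + K * bl_dist ({..<n} \<rightarrow>\<^sub>E UNIV) (sample_dist n) (marginal n PN) (marginal n QN)"
      unfolding K_def by (rule integral_discrepancy_le_bl_dist[OF n P_prob Pn Qn])
    also have "K * bl_dist ({..<n} \<rightarrow>\<^sub>E UNIV) (sample_dist n) (marginal n PN) (marginal n QN) \<le> K * \<delta>"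
      using close K by (intro mult_left_mono) auto
    finally have DQ: "(\<integral>z. discrepancy P n z \<partial>marginal n QN) \<le> 2 * \<tau> / 3"
      using DP \<delta>(2) by linarith
    have Dirac: "\<bar>(\<integral>\<mu>. f \<mu> \<partial>bootstrap_law n (Sn n) R) - f (return borel (S P))\<bar> \<le> \<epsilon> / 3"
      if R: "prob_space R" "sets R = sets (sample_algebra n)"
        and DR: "(\<integral>z. discrepancy P n z \<partial>R) \<le> 2 * \<tau> / 3"
        and f: "bl_norm borel_prob_measures (bl_dist UNIV dist) f \<le> 1"
          "f \<in> borel_measurable weak_borel" for R f
    proof -
      have "\<bar>(\<integral>\<mu>. f \<mu> \<partial>bootstrap_law n (Sn n) R) - f (return borel (S P))\<bar>
          \<le> \<epsilon> / 6 + 2 / d * ((\<integral>z. discrepancy P n z \<partial>R) + 2 * real m / sqrt n)"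
        using \<epsilon> d by (intro bootstrap_law_near_return[OF part n P_prob R Sn_continuous[OF n] _ _ near[OF n] f]) auto
      also have "\<dots> \<le> \<epsilon> / 6 + 2 / d * \<tau>"
        using DR small d by (intro add_left_mono mult_left_mono) auto
      finally show ?thesis using \<tau>(2) by simp
    qed
    have "bl_dist borel_prob_measures (bl_dist UNIV dist)
         (bootstrap_law n (Sn n) (marginal n PN))
         (bootstrap_law n (Sn n) (marginal n QN)) \<le> 2 * \<epsilon> / 3"
    proof (rule bl_dist_le)
      fix f :: "'h measure \<Rightarrow> real"
      assume f: "bl_norm borel_prob_measures (bl_dist UNIV dist) f \<le> 1"
      show "\<bar>(\<integral>\<mu>. f \<mu> \<partial>bootstrap_law n (Sn n) (marginal n PN))
          - (\<integral>\<mu>. f \<mu> \<partial>bootstrap_law n (Sn n) (marginal n QN))\<bar> \<le> 2 * \<epsilon> / 3"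
      proof (cases "f \<in> borel_measurable weak_borel")
        case True
        have "(\<integral>z. discrepancy P n z \<partial>marginal n PN) \<le> 2 * \<tau> / 3" using DP \<tau> by linarith
        from Dirac[OF Pn this f True] Dirac[OF Qn DQ f True] show ?thesis by linarith
      next
        \<comment> \<open>A non-measurable function has integral 0 with respect to both laws.\<close>
        case False
        have "\<not> integrable (bootstrap_law n (Sn n) R) f" for R
          using False borel_measurable_integrable[of "bootstrap_law n (Sn n) R" f]
          by (auto simp: bootstrap_law_def)
        then show ?thesis using \<epsilon> by (simp add: not_integrable_integral_eq)
      qed
    qed
    also have "\<dots> < \<epsilon>" using \<epsilon> by simp
    finally show "bl_dist borel_prob_measures (bl_dist UNIV dist)
         (bootstrap_law n (Sn n) (marginal n PN))
         (bootstrap_law n (Sn n) (marginal n QN)) < \<epsilon>" .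
  qed
qed

end
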